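(* The maps $h_1,h_2:M_p([0,\infty)^2)\to\mathbb D([0,\infty))$ defined in the context are almost surely continuous, in the $M_1$ topology of $\mathbb D([0,\infty))$, with respect to point processes in $M_p([0,\infty)^2)$ of Mori–Hsing type; that is, if $\tilde N$ is a point process of Mori–Hsing type then, with probability one, $\tilde N$ is a continuity point of $h_1$ and of $h_2$, where $M_p([0,\infty)^2)$ carries the vague topology and $\mathbb D([0,\infty))$ carries Skorokhod's $M_1$ topology.
   Context: $M_p([0,\infty)^2)$ is the space of Radon point measures on $[0,\infty)^2$. For $m=\sum_{i=1}^\infty\delta_{(t_i,y_i)}$, $h_1m$ and $h_2m$ are the real valued functions $$h_1m(t)=\begin{cases}\inf\{y_i:t_i\le t\}&\text{if }t>\underline t\\ \overline y&\text{if }t\le\underline t\end{cases},\qquad \underline t=\inf_it_i,\quad \overline y=\sup\{\inf\{y_i:t_i\le t\}:t>\underline t\},$$ $$h_2m(y)=\begin{cases}\inf\{t_i:y_i<y\}&\text{if }y>\underline y\\ \overline t&\text{if }y\le\underline y\end{cases},\qquad \underline y=\inf_iy_i,\quad \overline t=\sup\{\inf\{t_i:y_i<y\}:y>\underline y\}.$$ Mori–Hsing type: $\tilde N=\sum_{i,j=1}^\infty\sum_{\ell=1}^{K_{i,j}}\delta_{(T_{i,j},\,U_{i,j}Y_{i,j,\ell})}$, where, for some $\theta\in(0,1]$, $T_{i,j}=\sum_{\ell=1}^j\bar T_{i,\ell}$ with $(\bar T_{i,j})_{i,j\in\mathbb N}$ i.i.d. exponential of rate $\theta$; $(U_{i,j})_{i,j\in\mathbb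 N}$ are independent with $U_{i,j}$ uniform on $(i-1,i]$; $(Y_{i,j,\ell})_{\ell}$ are the points ($K_{i,j}$ in number) of a point process $\gamma_{i,j}$ on $[1,\infty)$ with $1$ as an atom; all the $\gamma_{i,j}$, $i,j\in\mathbb N$, are identically distributed; and $(\bar T_{i,j})_{i,j}$, $(U_{i,j})_{i,j}$ and $(Y_{i,j,\ell})_{i,j}$ are mutually independent for all $\ell$. $\mathbb D([0,\infty))$ (resp. $\mathbb D([0,T])$) is the space of real functions on $[0,\infty)$ (resp. $[0,T]$) that are right continuous with left-hand limits. $M_1$ topology: for $g\in\mathbb D([0,T])$ let $\Gamma(g)=\{(t,x)\in[0,T]\times\mathbb R: x\in[g(t^-)\wedge g(t),\,g(t^-)\vee g(t)]\}$ be its completed graph, and let $\Lambda^*(g)$ be the set of all its parametrizations, that is, all continuous $G=(\lambda,\gamma):[0,T]\to\Gamma(g)$ such that $t'<t$ implies either $\lambda(t')<\lambda(t)$, or $\lambda(t')=\lambda(t)$ and $|\gamma(t)-g(\lambda(t))|<|\gamma(t')-g(\lambda(t))|$. With $\|\cdot\|$ the uniform norm, put $$d_{M_1,T}(g_1,g_2)=\inf\{\|\lambda_1-\lambda_2\|\vee\|\gamma_1-\gamma_2\|:\ (\lambda_i,\gamma_i)\in\Lambda^*(g_i),\ i=1,2\}.$$ On $\mathbb D([0,\infty))$ the $M_1$ topology is defined by the metric $d_{M_1,\infty}(g_1,g_2)=\int_0^\infty e^{-t}(1\wedge d_{M_1,t}(g_1,g_2))\,dt$; convergence $g_n\to g$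 means that $d_{M_1,T}(g_n,g)\to0$ for every continuity point $T$ of $g$.
   Formalization: Since a.s. h_1, h_2 of a Mori–Hsing process equal ∞ at 0, functions take values in [0,∞] and d_{M_1} is applied after x/(1+x); h_2, left continuous as displayed, is replaced by its right-continuous version; parametrizations are taken onto the completed graph. *)

theory Defs
  imports "HOL-Probability.Probability"
begin

section \<open>Point measures and the vague topology\<close>

text \<open>The sum of the Dirac masses \<open>\<delta>(x i)\<close>, \<open>i \<in> I\<close>, as a Borel measure on \<open>S\<close>;
  it is only used when \<open>x\<close> maps \<open>I\<close> into \<open>S\<close>.\<close>

definition dirac_sum :: "'a::topological_space set \<Rightarrow> 'i set \<Rightarrow> ('i \<Rightarrow> 'a) \<Rightarrow> 'a measure" where
  "dirac_sum S I x = distr (count_space I) (restrict_space borel S) x"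

text \<open>Radon point measures on \<open>S\<close>. Finitely many points (even none) are allowed.\<close>

definition Mp :: "'a::topological_space set \<Rightarrow> 'a measure set" where
  "Mp S = {m. (\<exists>(I :: nat set) x. x \<in> I \<rightarrow> S \<and> m = dirac_sum S I x) \<and>
              (\<forall>C. compact C \<and> C \<subseteq> S \<longrightarrow> emeasure m C < \<infinity>)}"

definition Mp_algebra :: "'a::topological_space set \<Rightarrow> 'a measure measure" where
  "Mp_algebra S =
    (SUP A \<in> sets (restrict_space borel S). vimage_algebra (Mp S) (\<lambda>m. emeasure m A) borel)"

definition vague_topology :: "'a::topological_space set \<Rightarrow> 'a measure topology" where
  "vague_topology S = topology_generated_by
    {{m \<in> Mp S. (\<integral>x. f x \<partial>m) \<in> V} | (f :: 'a \<Rightarrow> real) V.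
      continuous_on S f \<and> (\<exists>C. compact C \<and> C \<subseteq> S \<and> (\<forall>x \<in> S - C. f x = 0)) \<and> open V}"

text \<open>For \<open>m = \<Sum>\<^sub>i \<delta>(x\<^sub>i)\<close> in \<open>Mp S\<close> this is the set of all \<open>x\<^sub>i\<close>.\<close>

definition atoms :: "'a measure \<Rightarrow> 'a set" where
  "atoms m = {x \<in> space m. emeasure m {x} \<noteq> 0}"

definition quadrant :: "(real \<times> real) set" where
  "quadrant = {0..} \<times> {0..}"


section \<open>The maps \<open>h\<^sub>1\<close> and \<open>h\<^sub>2\<close>\<close>

text \<open>Values are taken in \<open>[0, \<infinity>]\<close>: if the infimum \<open>t_low m\<close> is not attained by any point of
  \<open>m\<close>, the supremum \<open>y_top m\<close> is \<open>\<infinity>\<close>, and similarly for \<open>y_low\<close>, \<open>t_top\<close>.\<close>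

definition t_low :: "(real \<times> real) measure \<Rightarrow> ennreal" where
  "t_low m = (INF p \<in> atoms m. ennreal (fst p))"

definition y_low :: "(real \<times> real) measure \<Rightarrow> ennreal" where
  "y_low m = (INF p \<in> atoms m. ennreal (snd p))"

definition inf_y :: "(real \<times> real) measure \<Rightarrow> real \<Rightarrow> ennreal" where
  "inf_y m t = (INF p \<in> {p \<in> atoms m. fst p \<le> t}. ennreal (snd p))"

definition inf_t :: "(real \<times> real) measure \<Rightarrow> real \<Rightarrow> ennreal" where
  "inf_t m y = (INF p \<in> {p \<in> atoms m. snd p < y}. ennreal (fst p))"

definition y_top :: "(real \<times> real) measure \<Rightarrow> ennreal" where
  "y_top m = (SUP t \<in> {t. ennreal t > t_low m}. inf_y m t)"

definition t_top :: "(real \<times> real) measure \<Rightarrow> ennreal" where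
  "t_top m = (SUP y \<in> {y. ennreal y > y_low m}. inf_t m y)"

definition h1 :: "(real \<times> real) measure \<Rightarrow> real \<Rightarrow> ennreal" where
  "h1 m t = (if ennreal t > t_low m then inf_y m t else y_top m)"

definition h2 :: "(real \<times> real) measure \<Rightarrow> real \<Rightarrow> ennreal" where
  "h2 m y = (if ennreal y > y_low m then inf_t m y else t_top m)"

text \<open>Because of the strict inequality in \<open>inf_t\<close>, \<open>h2 m\<close> is left continuous with right-hand
  limits. The element of \<open>D([0,\<infinity>))\<close> it stands for is its right-continuous version, which has the
  same left- and right-hand limits and hence the same graph completed by vertical segments.\<close>

definition right_version :: "(real \<Rightarrow> 'b::t2_space) \<Rightarrow> real \<Rightarrow> 'b" where
  "right_version g t = Lim (at_right t) g"


section \<open>The \<open>M\<^sub>1\<close> topology\<close>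

text \<open>Functions on \<open>[0,\<infinity>)\<close> are total functions whose values at negative arguments are ignored.\<close>

definition cadlag :: "(real \<Rightarrow> 'b::topological_space) \<Rightarrow> bool" where
  "cadlag g \<longleftrightarrow> (\<forall>t\<ge>0. (g \<longlongrightarrow> g t) (at_right t)) \<and> (\<forall>t>0. \<exists>l. (g \<longlongrightarrow> l) (at_left t))"

definition left_value :: "(real \<Rightarrow> real) \<Rightarrow> real \<Rightarrow> real" where
  "left_value g t = (if t = 0 then g 0 else Lim (at_left t) g)"

definition completed_graph :: "real \<Rightarrow> (real \<Rightarrow> real) \<Rightarrow> (real \<times> real) set" where
  "completed_graph T g =
    {(t, x). t \<in> {0..T} \<and> x \<in> {min (left_value g t) (g t) .. max (left_value g t) (g t)}}"

text \<open>A parametrization of the completed graph runs through the whole graph.\<close>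

definition parametrizations ::
    "real \<Rightarrow> (real \<Rightarrow> real) \<Rightarrow> ((real \<Rightarrow> real) \<times> (real \<Rightarrow> real)) set" where
  "parametrizations T g =
    {(l, c). continuous_on {0..T} l \<and> continuous_on {0..T} c \<and>
       (\<lambda>t. (l t, c t)) ` {0..T} = completed_graph T g \<and>
       (\<forall>t \<in> {0..T}. \<forall>t' \<in> {0..T}. t' < t \<longrightarrow>
          l t' < l t \<or> (l t' = l t \<and> \<bar>c t - g (l t)\<bar> < \<bar>c t' - g (l t)\<bar>))}"

definition unif_dist :: "real \<Rightarrow> (real \<Rightarrow> real) \<Rightarrow> (real \<Rightarrow> real) \<Rightarrow> ennreal" where
  "unif_dist T f g = (SUP t \<in> {0..T}. ennreal \<bar>f t - g t\<bar>)"

definition dM1 :: "real \<Rightarrow> (real \<Rightarrow> real) \<Rightarrow> (real \<Rightarrow> real) \<Rightarrow> ennreal" where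
  "dM1 T g1 g2 =
    (INF (G1, G2) \<in> parametrizations T g1 \<times> parametrizations T g2.
       max (unif_dist T (fst G1) (fst G2)) (unif_dist T (snd G1) (snd G2)))"

definition dM1_inf :: "(real \<Rightarrow> real) \<Rightarrow> (real \<Rightarrow> real) \<Rightarrow> ennreal" where
  "dM1_inf g1 g2 = (\<integral>\<^sup>+t\<in>{0..}. (ennreal (exp (- t)) * min 1 (dM1 t g1 g2)) \<partial>lborel)"

text \<open>The increasing homeomorphism \<open>x \<mapsto> x / (1 + x)\<close> of \<open>[0,\<infinity>]\<close> onto \<open>[0,1]\<close>.\<close>

definition squash :: "ennreal \<Rightarrow> real" where
  "squash x = 1 - enn2real (inverse (1 + x))"

definition D_space :: "(real \<Rightarrow> ennreal) set" where
  "D_space = {g. cadlag g}"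

text \<open>The \<open>M\<^sub>1\<close> topology for \<open>[0,\<infinity>]\<close>-valued functions, given by the pseudometric \<open>dM1_inf\<close> (a metric
  up to values at negative arguments) after transport along \<open>squash\<close>. Since an element of
  \<open>D([0,T])\<close> with finite values and finite left limits is bounded, and \<open>squash\<close> is bi-Lipschitz on
  bounded sets, the topology induced on finite-valued functions with finite left limits is the
  usual \<open>M\<^sub>1\<close> topology of \<open>D([0,\<infinity>))\<close>. The value \<open>\<infinity>\<close> cannot be avoided: almost surely, \<open>h1\<close> and \<open>h2\<close>
  of a process of Mori--Hsing type are finite on \<open>(0,\<infinity>)\<close> but equal to \<open>\<infinity>\<close> at \<open>0\<close>.\<close>

definition M1_open :: "(real \<Rightarrow> ennreal) set \<Rightarrow> bool" where
  "M1_open V \<longleftrightarrow> V \<subseteq> D_space \<and>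
    (\<forall>g \<in> V. \<exists>e>0. \<forall>g' \<in> D_space. dM1_inf (squash \<circ> g) (squash \<circ> g') < e \<longrightarrow> g' \<in> V)"

definition M1_topology :: "(real \<Rightarrow> ennreal) topology" where
  "M1_topology = topology M1_open"

lemma istopology_M1_open: "istopology M1_open"
  unfolding istopology_def
proof (intro conjI allI impI)
  fix S T assume S: "M1_open S" and T: "M1_open T"
  show "M1_open (S \<inter> T)"
    unfolding M1_open_def
  proof (intro conjI ballI)
    show "S \<inter> T \<subseteq> D_space" using S by (auto simp: M1_open_def)
    fix g assume g: "g \<in> S \<inter> T"
    obtain e1 where e1: "e1 > 0"
      "\<And>g'. g' \<in> D_space \<Longrightarrow> dM1_inf (squash \<circ> g) (squash \<circ> g') < e1 \<Longrightarrow> g' \<in> S"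
      using S g by (auto simp: M1_open_def)
    obtain e2 where e2: "e2 > 0"
      "\<And>g'. g' \<in> D_space \<Longrightarrow> dM1_inf (squash \<circ> g) (squash \<circ> g') < e2 \<Longrightarrow> g' \<in> T"
      using T g by (auto simp: M1_open_def)
    show "\<exists>e>0. \<forall>g' \<in> D_space. dM1_inf (squash \<circ> g) (squash \<circ> g') < e \<longrightarrow> g' \<in> S \<inter> T"
      by (rule exI[of _ "min e1 e2"]) (use e1 e2 in auto)
  qed
next
  fix \<K> assume "\<forall>K\<in>\<K>. M1_open K"
  then show "M1_open (\<Union> \<K>)"
    unfolding M1_open_def by (meson Union_iff Union_least)
qed

lemma openin_M1_topology: "openin M1_topology = M1_open"
  unfolding M1_topology_def by (rule topology_inverse'[OF istopology_M1_open])

lemma topspace_M1_topology: "topspace M1_topology = D_space"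
proof -
  have "M1_open D_space"
    unfolding M1_open_def by (auto intro: exI[of _ 1])
  then show ?thesis
    unfolding topspace_def openin_M1_topology
    by (intro equalityI Union_least Union_upper) (auto simp: M1_open_def)
qed


section \<open>Point processes of Mori--Hsing type\<close>

text \<open>The sigma-algebra on \<open>\<Omega>\<close> generated by the family \<open>(X\<^sub>i)\<^sub>i\<close>, indexed by a whole type, of maps
  into \<open>N\<close>.\<close>

definition generated_events :: "'w set \<Rightarrow> 'b measure \<Rightarrow> ('i \<Rightarrow> 'w \<Rightarrow> 'b) \<Rightarrow> 'w set set" where
  "generated_events \<Omega> N X = sigma_sets \<Omega> {X i -` A \<inter> \<Omega> | i A. A \<in> sets N}"

text \<open>All indices start at \<open>0\<close>, so that \<open>U i j\<close> is uniform on \<open>(i, i + 1]\<close>. The points of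
  \<open>\<gamma>\<^sub>i\<^sub>j\<close> are the \<open>Y i j l\<close> with \<open>l < K i j\<close>; there may be infinitely many of them.\<close>

definition MH_cluster ::
    "(nat \<Rightarrow> nat \<Rightarrow> 'w \<Rightarrow> enat) \<Rightarrow> (nat \<Rightarrow> nat \<Rightarrow> nat \<Rightarrow> 'w \<Rightarrow> real) \<Rightarrow> nat \<Rightarrow> nat \<Rightarrow> 'w \<Rightarrow> real measure" where
  "MH_cluster K Y i j \<omega> = dirac_sum {1..} {l. enat l < K i j \<omega>} (\<lambda>l. Y i j l \<omega>)"

definition MH_process ::
    "(nat \<Rightarrow> nat \<Rightarrow> 'w \<Rightarrow> real) \<Rightarrow> (nat \<Rightarrow> nat \<Rightarrow> 'w \<Rightarrow> real) \<Rightarrow>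
     (nat \<Rightarrow> nat \<Rightarrow> 'w \<Rightarrow> enat) \<Rightarrow> (nat \<Rightarrow> nat \<Rightarrow> nat \<Rightarrow> 'w \<Rightarrow> real) \<Rightarrow> 'w \<Rightarrow> (real \<times> real) measure" where
  "MH_process Tbar U K Y \<omega> =
    dirac_sum quadrant {(i, j, l). enat l < K i j \<omega>}
      (\<lambda>(i, j, l). (\<Sum>k\<le>j. Tbar i k \<omega>, U i j \<omega> * Y i j l \<omega>))"

locale mori_hsing = prob_space M for M :: "'w measure" +
  fixes \<theta> :: real
    and Tbar U :: "nat \<Rightarrow> nat \<Rightarrow> 'w \<Rightarrow> real"
    and K :: "nat \<Rightarrow> nat \<Rightarrow> 'w \<Rightarrow> enat"
    and Y :: "nat \<Rightarrow> nat \<Rightarrow> nat \<Rightarrow> 'w \<Rightarrow> real"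
  assumes theta: "0 < \<theta>" "\<theta> \<le> 1"
    and Tbar_indep: "indep_vars (\<lambda>_. borel) (\<lambda>(i, j). Tbar i j) UNIV"
    and Tbar_exponential: "\<And>i j. distributed M lborel (Tbar i j) (exponential_density \<theta>)"
    and U_indep: "indep_vars (\<lambda>_. borel) (\<lambda>(i, j). U i j) UNIV"
    and U_uniform: "\<And>i j. distr M lborel (U i j) = uniform_measure lborel {real i <.. real i + 1}"
    and Y_ge_1: "\<And>i j l \<omega>. \<omega> \<in> space M \<Longrightarrow> enat l < K i j \<omega> \<Longrightarrow> 1 \<le> Y i j l \<omega>"
    and cluster_measurable: "\<And>i j. MH_cluster K Y i j \<in> M \<rightarrow>\<^sub>M Mp_algebra {1..}"
    and cluster_atom: "\<And>i j. AE \<omega> in M. 1 \<in> atoms (MH_cluster K Y i j \<omega>)"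
    and cluster_ident: "\<And>i j. distr M (Mp_algebra {1..}) (MH_cluster K Y i j) =
                               distr M (Mp_algebra {1..}) (MH_cluster K Y 0 0)"
    and families_indep: "indep_sets
          (nth [generated_events (space M) borel (\<lambda>(i, j). Tbar i j),
                generated_events (space M) borel (\<lambda>(i, j). U i j),
                generated_events (space M) (Mp_algebra {1..}) (\<lambda>(i, j). MH_cluster K Y i j)])
          {..<3}"

end

theory Submission
  imports Defs
begin

text \<open>Both maps only depend on the atoms, and the right-continuous version of \<open>h\<^sub>2\<close> is \<open>h\<^sub>1\<close> of the
  process with its two coordinates exchanged. As \<open>m\<close> converges vaguely, the decreasing
  function \<open>h\<^sub>1 m\<close> converges at every \<open>t > 0\<close> that is not the time of an atom of the limit. Almost
  surely the atoms of the limit have strictly positive coordinates that come arbitrarily close to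
  \<open>0\<close>, so \<open>h\<^sub>1\<close> starts at \<open>\<infinity>\<close>, and monotonicity gives convergence at \<open>0\<close> too. For decreasing
  functions, convergence at \<open>0\<close> and on a dense set implies convergence in \<open>M\<^sub>1\<close>: parametrize the
  completed graphs by \<open>t - x\<close>.\<close>

section \<open>Parametrizing the graph of a decreasing function\<close>

text \<open>Every parametrization on the horizon T starts at (0, g 0) and ends at (T, g T), so
  \<open>dM1 T\<close> dominates the differences of the values at both ends. Convergence at 0 is
  therefore indispensable, and a horizon T close to a jump of the limit is bad. Bad horizons are not
  discarded one by one: the error at T is bounded by a multiple of \<delta> plus twice the drop of
  the limit from T - \<delta> to T + \<delta>, and for a decreasing function with values in [0,1]
  this drop integrates over T to at most 2\<delta>. The result is an explicit bound on
  \<open>dM1_inf\<close>. It suits convergence along a neighbourhood filter, where dominated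
  convergence for sequences would not apply directly. The range [0,1] is supplied by
  \<open>squash\<close>. The delicate time is 0: measures near the limit may have atoms on the axes,
  so their value at 0 can be finite although the limit is \<infinity> there. The randomness has to
  supply atoms near both axes. Small times come from the first points of the infinitely many rows i;
  small heights come from the infinitely many points of row 0, the only row whose \<open>U\<close>
  can be close to 0.\<close>

text \<open>Since \<open>g\<close> decreases, \<open>t - x\<close> strictly increases along its completed graph; it serves as the
  parameter, and both coordinates are 1-Lipschitz functions of it.\<close>

definition shear_inv :: "real \<Rightarrow> (real \<Rightarrow> real) \<Rightarrow> real \<Rightarrow> real" where
  "shear_inv T g s = Inf (insert T {t \<in> {0..T}. s \<le> t - g t})"

lemma shear_inv_le:
  assumes "t \<in> {0..T}" "s \<le> t - g t"
  shows "shear_inv T g s \<le> t"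
  unfolding shear_inv_def
  by (rule cInf_lower) (use assms in \<open>auto intro!: bdd_belowI[of _ 0]\<close>)

text \<open>The premise \<open>t \<le> T\<close> takes care of the inserted element
  \<open>T\<close>, which keeps the set nonempty when no time reaches the level
  \<open>s\<close>.\<close>

lemma le_shear_inv:
  assumes "t \<le> T" "\<And>u. 0 \<le> u \<Longrightarrow> u < t \<Longrightarrow> u - g u < s"
  shows "t \<le> shear_inv T g s"
  unfolding shear_inv_def
proof (rule cInf_greatest)
  fix x assume "x \<in> insert T {t \<in> {0..T}. s \<le> t - g t}"
  with assms show "t \<le> x" by (force simp: not_less[symmetric])
qed simp

lemma shear_inv_mem:
  assumes "0 \<le> T"
  shows "shear_inv T g s \<in> {0..T}"
proof -
  have "shear_inv T g s \<le> T"
    unfolding shear_inv_def by (rule cInf_lower) (use assms in \<open>auto intro!: bdd_belowI[of _ 0]\<close>)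
  moreover have "0 \<le> shear_inv T g s"
    by (rule le_shear_inv) (use assms in auto)
  ultimately show ?thesis by simp
qed

lemma below_shear_inv:
  assumes "0 \<le> u" "u < shear_inv T g s" "0 \<le> T"
  shows "u - g u < s"
  using shear_inv_le[of u T s g] shear_inv_mem[of T g s] assms by force

lemma shear_inv_mono:
  assumes "0 \<le> T" "s \<le> s'"
  shows "shear_inv T g s \<le> shear_inv T g s'"
  using assms shear_inv_mem[of T g s]
  by (intro le_shear_inv) (auto dest: below_shear_inv[OF _ _ assms(1)])

text \<open>As \<open>g\<close> decreases, \<open>t - g t\<close> grows at least as fast as
  \<open>t\<close>, so a level higher by \<open>d\<close> is reached at most \<open>d\<close>
  later.\<close>

lemma shear_inv_lipschitz:
  assumes "antimono g" "0 \<le> T" "0 \<le> d"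
  shows "shear_inv T g (s + d) \<le> shear_inv T g s + d"
proof -
  have "shear_inv T g (s + d) - d \<le> shear_inv T g s"
  proof (rule le_shear_inv)
    show "shear_inv T g (s + d) - d \<le> T"
      using shear_inv_mem[OF assms(2), of g "s + d"] assms by auto
    fix u assume u: "0 \<le> u" "u < shear_inv T g (s + d) - d"
    then have "u + d - g (u + d) < s + d"
      using assms by (intro below_shear_inv[of _ T]) auto
    moreover have "g (u + d) \<le> g u"
      using assms by (intro antimonoD[OF assms(1)]) simp
    ultimately show "u - g u < s" by linarith
  qed
  then show ?thesis by simp
qed

lemma shear_inv_dist:
  assumes "antimono g" "0 \<le> T"
  shows "\<bar>shear_inv T g s - shear_inv T g s'\<bar> \<le> \<bar>s - s'\<bar>"
  using shear_inv_lipschitz[OF assms, of "s' - s" s] shear_inv_lipschitz[OF assms, of "s - s'" s']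
    shear_inv_mono[OF assms(2), of s s' g] shear_inv_mono[OF assms(2), of s' s g]
  by (cases "s \<le> s'") auto

text \<open>If \<open>g\<close> has reached level \<open>s\<close> at time \<open>u\<close>, then
  \<open>g'\<close> has reached level \<open>s - \<delta>\<close> at time \<open>u + \<eta>\<close>.
  The missing \<delta> of level costs at most \<delta> more time, by the Lipschitz bound.\<close>

lemma shear_inv_compare:
  assumes "antimono g'" "0 \<le> T" "0 \<le> \<eta>" "0 \<le> \<delta>"
    and close: "\<And>t. t \<in> {0..T} \<Longrightarrow> g' (t + \<eta>) \<le> g t + \<delta>"
  shows "shear_inv T g' s \<le> shear_inv T g s + (\<eta> + \<delta>)"
proof -
  have "shear_inv T g' (s - \<delta>) - \<eta> \<le> shear_inv T g s"
  proof (rule le_shear_inv)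
    show "shear_inv T g' (s - \<delta>) - \<eta> \<le> T"
      using shear_inv_mem[OF assms(2), of g' "s - \<delta>"] assms by auto
    fix u assume u: "0 \<le> u" "u < shear_inv T g' (s - \<delta>) - \<eta>"
    then have "u + \<eta> - g' (u + \<eta>) < s - \<delta>"
      using assms by (intro below_shear_inv[of _ T]) auto
    moreover have "g' (u + \<eta>) \<le> g u + \<delta>"
      using close[of u] u shear_inv_mem[OF assms(2), of g' "s - \<delta>"] assms by auto
    ultimately show "u - g u < s" using assms by linarith
  qed
  with shear_inv_lipschitz[OF assms(1,2,4), of "s - \<delta>"] show ?thesis by simp
qed

text \<open>Right continuity makes the infimum a minimum: otherwise the level would still be missed
  on an interval to the right of it. The bound on \<open>s\<close> puts \<open>T\<close> itself into
  the set, so that its insertion adds nothing.\<close>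

lemma shear_inv_attained:
  assumes "0 \<le> T" "cadlag g" "s \<le> T - g T"
  shows "s \<le> shear_inv T g s - g (shear_inv T g s)"
proof (rule ccontr)
  let ?t = "shear_inv T g s"
  assume "\<not> ?thesis"
  then have lt: "?t - g ?t < s" by simp
  have t: "?t \<in> {0..T}" using assms by (intro shear_inv_mem)
  with lt assms(3) have "?t < T" by (cases "?t = T") auto
  have "(g \<longlongrightarrow> g ?t) (at_right ?t)"
    using t assms by (auto simp: cadlag_def)
  then have "((\<lambda>u. u - g u) \<longlongrightarrow> ?t - g ?t) (at_right ?t)"
    by (intro tendsto_intros)
  then have "\<forall>\<^sub>F u in at_right ?t. u - g u < s"
    using lt by (rule order_tendstoD)
  then obtain b where b: "b > ?t" "\<And>u. u > ?t \<Longrightarrow> u < b \<Longrightarrow> u - g u < s"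
    unfolding eventually_at_right_field by blast
  have "min b T \<le> ?t"
  proof (rule le_shear_inv)
    fix u assume u: "0 \<le> u" "u < min b T"
    show "u - g u < s"
      using u b(2) lt below_shear_inv[of u T g s] assms
      by (cases u ?t rule: linorder_cases) auto
  qed simp
  with b \<open>?t < T\<close> show False by auto
qed

lemma tendsto_left_value:
  assumes "cadlag g" "0 < t"
  shows "(g \<longlongrightarrow> left_value g t) (at_left t)"
proof -
  obtain l where l: "(g \<longlongrightarrow> l) (at_left t)"
    using assms by (auto simp: cadlag_def)
  then have "Lim (at_left t) g = l"
    by (intro tendsto_Lim) auto
  with l assms show ?thesis by (simp add: left_value_def)
qed

lemma left_value_le:
  assumes "cadlag g" "antimono g" "0 \<le> u" "u < t"
  shows "left_value g t \<le> g u"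
proof (rule tendsto_upperbound)
  show "(g \<longlongrightarrow> left_value g t) (at_left t)"
    using assms by (intro tendsto_left_value) auto
  show "\<forall>\<^sub>F i in at_left t. g i \<le> g u"
    unfolding eventually_at_left_field using assms by (intro exI[of _ u]) (auto intro: antimonoD[OF assms(2)])
qed auto

lemma le_left_value:
  assumes "cadlag g" "antimono g" "0 < t" "\<And>u. 0 \<le> u \<Longrightarrow> u < t \<Longrightarrow> u - s \<le> g u"
  shows "t - s \<le> left_value g t"
proof (rule tendsto_le)
  show "(g \<longlongrightarrow> left_value g t) (at_left t)"
    using assms by (intro tendsto_left_value) auto
  show "((\<lambda>u. u - s) \<longlongrightarrow> t - s) (at_left t)"
    by (intro tendsto_intros)
  show "\<forall>\<^sub>F u in at_left t. u - s \<le> g u"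
    unfolding eventually_at_left_field using assms by (intro exI[of _ 0]) auto
qed auto

lemma le_left_value_self:
  assumes "cadlag g" "antimono g" "0 \<le> t"
  shows "g t \<le> left_value g t"
proof (cases "t = 0")
  case False
  then show ?thesis
    using assms tendsto_left_value[of g t]
    by (intro tendsto_lowerbound[of g "left_value g t" "at_left t"])
       (auto simp: eventually_at_left_field intro!: exI[of _ 0] intro: antimonoD[OF assms(2)])
qed (simp add: left_value_def)

text \<open>Parametrizations live on [0,T], whereas \<open>t - x\<close> runs over the interval from
  \<open>- g 0\<close> to \<open>T - g T\<close> along the graph. Written as a convex combination of
  these ends, the scales of two functions differ by no more than their ends do.\<close>

definition shear_scale :: "real \<Rightarrow> (real \<Rightarrow> real) \<Rightarrow> real \<Rightarrow> real" where
  "shear_scale T g u = (1 - u / T) * (- g 0) + (u / T) * (T - g T)"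

lemma shear_scale_bij:
  assumes "0 < T" "antimono g"
  shows "shear_scale T g ` {0..T} = {- g 0 .. T - g T}"
    and "strict_mono (shear_scale T g)"
proof -
  define L where "L = T - g T + g 0"
  have L: "0 < L" using assms antimonoD[of g 0 T] by (auto simp: L_def)
  have eq: "shear_scale T g u = - g 0 + u / T * L" for u
    by (simp add: shear_scale_def L_def algebra_simps)
  show "strict_mono (shear_scale T g)"
    using assms L by (auto simp: strict_mono_def eq divide_strict_right_mono)
  show "shear_scale T g ` {0..T} = {- g 0 .. T - g T}"
  proof (intro equalityI subsetI)
    fix s assume "s \<in> shear_scale T g ` {0..T}"
    then obtain u where u: "u \<in> {0..T}" "s = - g 0 + u / T * L" by (auto simp: eq)
    have "u / T \<le> 1" "0 \<le> u / T" using u assms by auto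
    then have "u / T * L \<le> 1 * L" "0 \<le> u / T * L"
      using L by (intro mult_right_mono mult_nonneg_nonneg; simp)+
    then show "s \<in> {- g 0 .. T - g T}" 
      unfolding u(2) atLeastAtMost_iff using L_def by (intro conjI; linarith)
  next
    fix s assume s: "s \<in> {- g 0 .. T - g T}"
    then have "s = shear_scale T g ((s + g 0) / L * T)"
      using assms L by (auto simp: eq)
    moreover have "0 \<le> (s + g 0) / L" "(s + g 0) / L \<le> 1"
      using s L by (auto simp: L_def)
    then have "(s + g 0) / L * T \<in> {0..T}"
      using assms mult_right_mono[of "(s + g 0) / L" 1 T] mult_nonneg_nonneg[of "(s + g 0) / L" T] by simp
    ultimately show "s \<in> shear_scale T g ` {0..T}" by blast
  qed
qed

text \<open>A graph point (t, x) has level \<open>t - x\<close>, and \<open>shear_inv\<close>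
  recovers t because \<open>g\<close> is at least x before t. Conversely, the height
  \<open>shear_inv T g s - s\<close> lies above \<open>g\<close> since the infimum is attained, and
  below the left limit since earlier times miss the level.\<close>

lemma shear_parametrization:
  assumes "0 < T" "cadlag g" "antimono g"
  shows "(\<lambda>u. shear_inv T g (shear_scale T g u),
          \<lambda>u. shear_inv T g (shear_scale T g u) - shear_scale T g u) \<in> parametrizations T g"
proof -
  let ?l = "shear_inv T g" and ?s = "shear_scale T g" and ?S = "{- g 0 .. T - g T}"
  have T: "0 \<le> T" using assms by simp
  have cont_l: "continuous_on UNIV ?l"
    by (rule lipschitz_on_continuous_on[of 1])
       (auto simp: lipschitz_on_def dist_real_def shear_inv_dist[OF assms(3) T])
  have cont_s: "continuous_on A (shear_scale T g)" for A
    unfolding shear_scale_def using assms by (intro continuous_intros) auto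
  have graph: "completed_graph T g = (\<lambda>s. (?l s, ?l s - s)) ` ?S"
  proof (intro equalityI subsetI)
    fix p assume "p \<in> completed_graph T g"
    then obtain t x where p: "p = (t, x)" "t \<in> {0..T}" "g t \<le> x" "x \<le> left_value g t"
      using le_left_value_self[OF assms(2,3)] by (force simp: completed_graph_def)
    have "?l (t - x) \<le> t"
      using p by (intro shear_inv_le) auto
    moreover have "t \<le> ?l (t - x)"
    proof (rule le_shear_inv)
      fix u assume u: "0 \<le> u" "u < t"
      then have "x \<le> g u" using p left_value_le[OF assms(2,3) u] by simp
      with u show "u - g u < t - x" by simp
    qed (use p in simp)
    moreover have "t - x \<in> ?S"
    proof -
      have "g T \<le> g t" using p by (intro antimonoD[OF assms(3)]) simp
      moreover have "x \<le> g 0"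
        using p left_value_le[OF assms(2,3), of 0 t] by (cases "t = 0") (auto simp: left_value_def)
      ultimately show ?thesis using p by auto
    qed
    ultimately show "p \<in> (\<lambda>s. (?l s, ?l s - s)) ` ?S"
      using p by (intro image_eqI[of _ _ "t - x"]) auto
  next
    fix p assume "p \<in> (\<lambda>s. (?l s, ?l s - s)) ` ?S"
    then obtain s where s: "p = (?l s, ?l s - s)" "s \<in> ?S" by blast
    have mem: "?l s \<in> {0..T}" by (rule shear_inv_mem[OF T])
    have "g (?l s) \<le> ?l s - s"
      using shear_inv_attained[OF T assms(2), of s] s by simp
    moreover have "?l s - s \<le> left_value g (?l s)"
    proof (cases "?l s = 0")
      case False
      then show ?thesis
        using mem below_shear_inv[OF _ _ T, of _ g s]
        by (intro le_left_value[OF assms(2,3)]) force+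
    qed (use s in \<open>auto simp: left_value_def\<close>)
    ultimately show "p \<in> completed_graph T g"
      using s mem by (auto simp: completed_graph_def min_def max_def)
  qed
  \<comment> \<open>While the time stands still, the height \<open>?l s - s\<close> falls strictly
    as \<open>s\<close> grows but stays at or above \<open>g (?l s)\<close>, so it approaches that
    value.\<close>
  have "?l s' < ?l s \<or> (?l s' = ?l s \<and> \<bar>(?l s - s) - g (?l s)\<bar> < \<bar>(?l s' - s') - g (?l s)\<bar>)"
    if "s' < s" "s \<in> ?S" for s s'
    using that shear_inv_mono[OF T, of s' s g] shear_inv_attained[OF T assms(2), of s] by auto
  moreover have "shear_scale T g t' < shear_scale T g t" if "t' < t" for t t'
    using shear_scale_bij(2)[OF assms(1,3)] that by (auto simp: strict_mono_def)
  moreover have "shear_scale T g t \<in> ?S" if "t \<in> {0..T}" for t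
    using shear_scale_bij(1)[OF assms(1,3)] that by blast
  ultimately have "\<forall>t \<in> {0..T}. \<forall>t' \<in> {0..T}. t' < t \<longrightarrow>
      ?l (?s t') < ?l (?s t) \<or> (?l (?s t') = ?l (?s t) \<and>
        \<bar>(?l (?s t) - ?s t) - g (?l (?s t))\<bar> < \<bar>(?l (?s t') - ?s t') - g (?l (?s t))\<bar>)"
    by blast
  moreover have "continuous_on {0..T} (\<lambda>u. ?l (?s u))"
    by (rule continuous_on_compose2[OF cont_l cont_s]) auto
  then have "continuous_on {0..T} (\<lambda>u. ?l (?s u) - ?s u)"
    by (intro continuous_intros cont_s)
  moreover have "(\<lambda>u. (?l (?s u), ?l (?s u) - ?s u)) ` {0..T} = completed_graph T g"
    unfolding graph shear_scale_bij(1)[OF assms(1,3), symmetric] image_image ..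
  ultimately show ?thesis
    using \<open>continuous_on {0..T} (\<lambda>u. ?l (?s u))\<close> unfolding parametrizations_def by simp
qed

text \<open>Both graphs are run through with the same parameter u. The two levels differ by at most
  the end differences \<open>?d\<close>; the times then differ by \<eta> + \<delta> at equal levels,
  plus \<open>?d\<close> by the Lipschitz bound. A height is time minus level, which costs a second
  \<open>?d\<close>.\<close>

lemma dM1_le:
  assumes "0 < T" "cadlag g" "antimono g" "cadlag g'" "antimono g'" "0 \<le> \<eta>" "0 \<le> \<delta>"
    and close: "\<And>t. t \<in> {0..T} \<Longrightarrow> g' (t + \<eta>) \<le> g t + \<delta>"
               "\<And>t. t \<in> {0..T} \<Longrightarrow> g (t + \<eta>) \<le> g' t + \<delta>"
  shows "dM1 T g g' \<le> ennreal (\<eta> + \<delta> + 2 * (\<bar>g 0 - g' 0\<bar> + \<bar>g T - g' T\<bar>))"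
proof -
  let ?s = "shear_scale T g" and ?s' = "shear_scale T g'"
  let ?l = "shear_inv T g" and ?l' = "shear_inv T g'"
  let ?d = "\<bar>g 0 - g' 0\<bar> + \<bar>g T - g' T\<bar>"
  have T: "0 \<le> T" using assms by simp
  have s: "\<bar>?s u - ?s' u\<bar> \<le> ?d" if "u \<in> {0..T}" for u
  proof -
    have "\<bar>?s u - ?s' u\<bar> = \<bar>(1 - u / T) * (g' 0 - g 0) + (u / T) * (g' T - g T)\<bar>"
      by (simp add: shear_scale_def algebra_simps)
    also have "\<dots> \<le> (1 - u / T) * \<bar>g' 0 - g 0\<bar> + (u / T) * \<bar>g' T - g T\<bar>"
      using that assms by (intro order_trans[OF abs_triangle_ineq]) (auto simp: abs_mult)
    also have "\<dots> \<le> 1 * \<bar>g' 0 - g 0\<bar> + 1 * \<bar>g' T - g T\<bar>"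
      using that assms by (intro add_mono mult_right_mono) auto
    finally show ?thesis by simp
  qed
  have l: "\<bar>?l (?s u) - ?l' (?s' u)\<bar> \<le> \<eta> + \<delta> + ?d" if "u \<in> {0..T}" for u
    using shear_inv_compare[OF assms(3) T assms(6,7) close(2), of "?s u"]
      shear_inv_compare[OF assms(5) T assms(6,7) close(1), of "?s u"]
      shear_inv_dist[OF assms(5) T, of "?s u" "?s' u"] s[OF that]
    by auto
  have "unif_dist T (\<lambda>u. ?l (?s u)) (\<lambda>u. ?l' (?s' u)) \<le> ennreal (\<eta> + \<delta> + 2 * ?d)"
    unfolding unif_dist_def by (intro SUP_least ennreal_leI order_trans[OF l]) auto
  moreover have "\<bar>(?l (?s u) - ?s u) - (?l' (?s' u) - ?s' u)\<bar> \<le> \<eta> + \<delta> + 2 * ?d"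
    if "u \<in> {0..T}" for u
  proof -
    have "\<bar>(?l (?s u) - ?s u) - (?l' (?s' u) - ?s' u)\<bar>
        \<le> \<bar>?l (?s u) - ?l' (?s' u)\<bar> + \<bar>?s u - ?s' u\<bar>"
      by linarith
    also have "\<dots> \<le> (\<eta> + \<delta> + ?d) + ?d" by (rule add_mono[OF l s]) (rule that)+
    finally show ?thesis by simp
  qed
  then have "unif_dist T (\<lambda>u. ?l (?s u) - ?s u) (\<lambda>u. ?l' (?s' u) - ?s' u)
      \<le> ennreal (\<eta> + \<delta> + 2 * ?d)"
    unfolding unif_dist_def by (intro SUP_least ennreal_leI) auto
  ultimately show ?thesis
    unfolding dM1_def
    using shear_parametrization[OF assms(1-3)] shear_parametrization[OF assms(1,4,5)]
    by (intro INF_lower2[of "((\<lambda>u. ?l (?s u), \<lambda>u. ?l (?s u) - ?s u),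
        (\<lambda>u. ?l' (?s' u), \<lambda>u. ?l' (?s' u) - ?s' u))"]) auto
qed


section \<open>\<open>M\<^sub>1\<close> convergence of decreasing functions\<close>

lemma borel_measurable_antimono:
  fixes g :: "real \<Rightarrow> real"
  assumes "antimono g"
  shows "g \<in> borel_measurable borel"
proof -
  have "mono (\<lambda>x. - g x)" using assms by (auto simp: monotone_on_def)
  then have "(\<lambda>x. - (- g x)) \<in> borel_measurable borel"
    by (intro borel_measurable_uminus borel_measurable_mono)
  then show ?thesis by simp
qed

lemma nn_integral_exp_tail: "(\<integral>\<^sup>+t. ennreal (exp (- t)) * indicator {a..} t \<partial>lborel) = ennreal (exp (- a))"
proof -
  have "((\<lambda>t :: real. exp (- t)) \<longlongrightarrow> 0) at_top"
    by (rule filterlim_compose[OF exp_at_bot filterlim_uminus_at_bot_at_top])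
  then have "((\<lambda>t :: real. - exp (- t)) \<longlongrightarrow> 0) at_top"
    by (auto dest: tendsto_minus)
  then have "(\<integral>\<^sup>+t. ennreal (exp (- t)) * indicator {a..} t \<partial>lborel) = ennreal (0 - (- exp (- a)))"
    by (intro nn_integral_FTC_atLeast[where F = "\<lambda>t. - exp (- t)"])
       (auto intro!: derivative_eq_intros)
  then show ?thesis by simp
qed

text \<open>The shifted integrals telescope.\<close>

lemma nn_integral_shift_difference:
  fixes g :: "real \<Rightarrow> real"
  assumes "antimono g" "range g \<subseteq> {0..1}" "0 \<le> \<delta>"
  shows "(\<integral>\<^sup>+t. ennreal (g (t - \<delta>) - g (t + \<delta>)) * indicator {\<delta><..R} t \<partial>lborel) \<le> ennreal (2 * \<delta>)"
    (is "?D \<le> _")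
proof -
  have [measurable]: "g \<in> borel_measurable borel"
    by (rule borel_measurable_antimono[OF assms(1)])
  have g: "0 \<le> g x" "g x \<le> 1" for x
    using assms(2) by (auto simp: image_subset_iff)
  let ?B = "\<integral>\<^sup>+t. ennreal (g (t + \<delta>)) * indicator {\<delta><..R} t \<partial>lborel"
  have le: "g (t + \<delta>) \<le> g (t - \<delta>)" for t
    using assms(3) by (intro antimonoD[OF assms(1)]) simp
  have "?D + ?B = (\<integral>\<^sup>+t. ennreal (g (t - \<delta>)) * indicator {\<delta><..R} t \<partial>lborel)"
    by (subst nn_integral_add[symmetric], simp, simp, rule nn_integral_cong)
       (auto simp: g le ennreal_plus[symmetric] indicator_def simp del: ennreal_plus)
  also have "\<dots> = (\<integral>\<^sup>+u. ennreal (g u) * indicator {0<..R - \<delta>} u \<partial>lborel)"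
    by (subst (2) nn_integral_real_affine[where c = 1 and t = "- \<delta>"])
       (auto intro!: nn_integral_cong simp: indicator_def)
  \<comment> \<open>The two translated integrals of \<open>g\<close> run over (0, R - \<delta>] and
    (2\<delta>, R + \<delta>]. The former exceeds the latter at most by its part on (0, 2\<delta>],
    where \<open>g\<close> is at most 1.\<close>
  also have "\<dots> \<le> (\<integral>\<^sup>+u. indicator {0<..2 * \<delta>} u + ennreal (g u) * indicator {2 * \<delta><..R + \<delta>} u \<partial>lborel)"
    using assms(3) by (intro nn_integral_mono) (auto simp: indicator_def g)
  also have "\<dots> = ennreal (2 * \<delta>) + (\<integral>\<^sup>+u. ennreal (g u) * indicator {2 * \<delta><..R + \<delta>} u \<partial>lborel)"
    using assms(3) by (subst nn_integral_add) auto
  also have "(\<integral>\<^sup>+u. ennreal (g u) * indicator {2 * \<delta><..R + \<delta>} u \<partial>lborel) = ?B"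
    by (subst nn_integral_real_affine[where c = 1 and t = \<delta>])
       (auto intro!: nn_integral_cong simp: indicator_def add.commute)
  finally have *: "?B + ?D \<le> ?B + ennreal (2 * \<delta>)" by (simp add: add.commute)
  \<comment> \<open>Finiteness of \<open>?B\<close> is what permits cancelling it in
    \<open>ennreal\<close>.\<close>
  have "?B \<le> (\<integral>\<^sup>+t. indicator {\<delta><..R} t \<partial>lborel)"
    by (intro nn_integral_mono) (auto simp: indicator_def g)
  also have "\<dots> < \<infinity>" by (cases "\<delta> \<le> R") auto
  finally show ?thesis using * by (auto simp: ennreal_add_left_cancel_le)
qed

text \<open>Times up to \<delta> contribute \<delta>, times beyond R the tail
  \<open>exp (- R)\<close>; there the integrand is bounded through \<open>min 1\<close>. In between,
  the bound on \<open>dM1 t\<close> contributes 6\<delta> and twice an oscillation of integral at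
  most 2\<delta>, so 11 = 1 + 6 + 4.\<close>

lemma dM1_inf_le:
  assumes g: "cadlag g" "antimono g" "range g \<subseteq> {0..1}"
    and g': "cadlag g'" "antimono g'" "range g' \<subseteq> {0..1}"
    and \<delta>: "0 < \<delta>" and zero: "\<bar>g 0 - g' 0\<bar> \<le> \<delta>"
    and close: "\<And>t. t \<in> {0..R} \<Longrightarrow> g' (t + \<delta>) \<le> g t + \<delta> \<and> g (t + \<delta>) \<le> g' t + \<delta>"
  shows "dM1_inf g g' \<le> ennreal (11 * \<delta> + exp (- R))"
proof -
  have [measurable]: "g \<in> borel_measurable borel"
    by (rule borel_measurable_antimono[OF g(2)])
  let ?osc = "\<lambda>t. ennreal (g (t - \<delta>) - g (t + \<delta>)) * indicator {\<delta><..R} t"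
  have bound: "dM1 t g g' \<le> ennreal (6 * \<delta>) + 2 * ennreal (g (t - \<delta>) - g (t + \<delta>))"
    if t: "\<delta> < t" "t \<le> R" for t
  proof -
    have osc: "0 \<le> g (t - \<delta>) - g (t + \<delta>)"
      using \<delta> antimonoD[OF g(2), of "t - \<delta>" "t + \<delta>"] by simp
    \<comment> \<open>Both \<open>g t\<close> and \<open>g' t\<close> lie between
      \<open>g (t + \<delta>) - \<delta>\<close> and \<open>g (t - \<delta>) + \<delta>\<close>.
      With the \<delta> allowed at 0 and the two shifts this makes 6\<delta>.\<close>
    have "\<bar>g t - g' t\<bar> \<le> g (t - \<delta>) - g (t + \<delta>) + \<delta>"
      using close[of "t - \<delta>"] close[of t] t \<delta>
        antimonoD[OF g(2), of "t - \<delta>" t] antimonoD[OF g(2), of t "t + \<delta>"] by auto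
    moreover have "\<delta> + \<delta> + 2 * (x + y) \<le> 6 * \<delta> + 2 * z" if "x \<le> \<delta>" "y \<le> z + \<delta>" for x y z
      using that by simp
    ultimately have le: "\<delta> + \<delta> + 2 * (\<bar>g 0 - g' 0\<bar> + \<bar>g t - g' t\<bar>) \<le> 6 * \<delta> + 2 * (g (t - \<delta>) - g (t + \<delta>))"
      using zero by blast
    have "dM1 t g g' \<le> ennreal (\<delta> + \<delta> + 2 * (\<bar>g 0 - g' 0\<bar> + \<bar>g t - g' t\<bar>))"
      using t \<delta> close by (intro dM1_le g g') auto
    also have "\<dots> \<le> ennreal (6 * \<delta> + 2 * (g (t - \<delta>) - g (t + \<delta>)))"
      by (intro ennreal_leI le)
    also have "\<dots> = ennreal (6 * \<delta>) + ennreal (2 * (g (t - \<delta>) - g (t + \<delta>)))"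
      using \<delta> osc by (intro ennreal_plus) auto
    also have "ennreal (2 * (g (t - \<delta>) - g (t + \<delta>))) = 2 * ennreal (g (t - \<delta>) - g (t + \<delta>))"
      using osc by (subst ennreal_mult) auto
    finally show ?thesis .
  qed
  have "dM1_inf g g' \<le> (\<integral>\<^sup>+t. indicator {0..\<delta>} t + ennreal (6 * \<delta>) * (ennreal (exp (- t)) * indicator {0..} t)
      + 2 * ?osc t + ennreal (exp (- t)) * indicator {R..} t \<partial>lborel)"
    unfolding dM1_inf_def
  \<comment> \<open>Monotonicity of the nonnegative integral holds without measurability of
    \<open>dM1 t g g'\<close> in \<open>t\<close>.\<close>
  proof (rule nn_integral_mono)
    fix t :: real
    consider "t < 0" | "0 \<le> t" "t \<le> \<delta>" | "\<delta> < t" "R < t" | "\<delta> < t" "t \<le> R" by linarith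
    then show "ennreal (exp (- t)) * min 1 (dM1 t g g') * indicator {0..} t
      \<le> indicator {0..\<delta>} t + ennreal (6 * \<delta>) * (ennreal (exp (- t)) * indicator {0..} t)
        + 2 * ?osc t + ennreal (exp (- t)) * indicator {R..} t" (is "?lhs \<le> ?a + ?b + ?c + ?d")
    proof cases
      case 1
      then show ?thesis by simp
    next
      case 2
      then have "?lhs = ennreal (exp (- t)) * min 1 (dM1 t g g')" by simp
      also have "\<dots> \<le> 1 * 1" using 2 by (intro mult_mono) auto
      also have "1 * 1 \<le> ?a + (?b + ?c + ?d)"
        using 2 by simp
      finally show ?thesis by (simp only: add.assoc)
    next
      case 3
      then have "?lhs = ennreal (exp (- t)) * min 1 (dM1 t g g')" using \<delta> by simp
      also have "\<dots> \<le> ennreal (exp (- t)) * 1" by (intro mult_left_mono) auto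
      also have "\<dots> \<le> ?d" using 3 by simp
      also have "?d \<le> (?a + ?b + ?c) + ?d" by (rule add_increasing) auto
      finally show ?thesis .
    next
      case 4
      then have "?lhs = ennreal (exp (- t)) * min 1 (dM1 t g g')" using \<delta> by simp
      also have "\<dots> \<le> ennreal (exp (- t)) * (ennreal (6 * \<delta>) + 2 * ennreal (g (t - \<delta>) - g (t + \<delta>)))"
        using bound[OF 4] by (intro mult_left_mono min.coboundedI2) auto
      also have "\<dots> = ennreal (6 * \<delta>) * ennreal (exp (- t)) + ennreal (exp (- t)) * (2 * ennreal (g (t - \<delta>) - g (t + \<delta>)))"
        by (simp add: distrib_left mult.commute)
      also have "\<dots> \<le> ?b + 1 * ?c"
        using 4 \<delta> by (intro add_mono mult_mono) auto
      also have "\<dots> = ?b + ?c" by simp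
      also have "\<dots> \<le> ?a + (?b + ?c) + ?d"
        by (rule add_increasing2[OF zero_le add_increasing[OF zero_le order_refl]])
      finally show ?thesis by (simp only: add.assoc)
    qed
  qed
  also have "\<dots> = ennreal \<delta> + ennreal (6 * \<delta>) + 2 * (\<integral>\<^sup>+t. ?osc t \<partial>lborel) + ennreal (exp (- R))"
    using \<delta> by (simp add: nn_integral_add nn_integral_cmult nn_integral_exp_tail)
  also have "\<dots> \<le> ennreal \<delta> + ennreal (6 * \<delta>) + 2 * ennreal (2 * \<delta>) + ennreal (exp (- R))"
    using \<delta> g by (intro add_mono mult_left_mono nn_integral_shift_difference) auto
  also have "2 * ennreal (2 * \<delta>) = ennreal (4 * \<delta>)"
    using \<delta> by (subst ennreal_numeral[symmetric], subst ennreal_mult[symmetric]) auto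
  also have "ennreal \<delta> + ennreal (6 * \<delta>) + ennreal (4 * \<delta>) + ennreal (exp (- R)) = ennreal (11 * \<delta> + exp (- R))"
    using \<delta> by (simp add: ennreal_plus[symmetric] del: ennreal_plus)
  finally show ?thesis .
qed

text \<open>One convergence point is chosen in each cell of a grid of mesh \<delta>/2. Every
  interval (t, t + \<delta>) contains a whole cell, so monotonicity carries closeness at finitely
  many points over to all of [0,R].\<close>

lemma eventually_close:
  fixes g :: "real \<Rightarrow> real" and h :: "'m \<Rightarrow> real \<Rightarrow> real"
  assumes "antimono g" "\<forall>\<^sub>F m in F. antimono (h m)" "0 < \<delta>"
    and dense: "\<And>a b. 0 \<le> a \<Longrightarrow> a < b \<Longrightarrow> \<exists>t. a < t \<and> t < b \<and> ((\<lambda>m. h m t) \<longlongrightarrow> g t) F"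
  shows "\<forall>\<^sub>F m in F. \<forall>t\<in>{0..R}. h m (t + \<delta>) \<le> g t + \<delta> \<and> g (t + \<delta>) \<le> h m t + \<delta>"
proof -
  have "\<exists>t. real k * (\<delta> / 2) < t \<and> t < real (Suc k) * (\<delta> / 2) \<and> ((\<lambda>m. h m t) \<longlongrightarrow> g t) F" for k
    using assms(3) by (intro dense mult_strict_right_mono) auto
  then obtain \<tau> where \<tau>: "\<And>k. real k * (\<delta> / 2) < \<tau> k" "\<And>k. \<tau> k < real (Suc k) * (\<delta> / 2)"
      "\<And>k. ((\<lambda>m. h m (\<tau> k)) \<longlongrightarrow> g (\<tau> k)) F"
    by metis
  have "\<exists>k \<le> nat \<lfloor>R / (\<delta> / 2)\<rfloor> + 1. t < \<tau> k \<and> \<tau> k < t + \<delta>" if t: "t \<in> {0..R}" for t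
  proof -
    \<comment> \<open>The cell after the one containing \<open>t\<close>: it starts strictly after
      \<open>t\<close> and ends no later than \<open>t + \<delta>\<close>.\<close>
    define k where "k = nat \<lfloor>t / (\<delta> / 2)\<rfloor> + 1"
    have k: "real k = of_int \<lfloor>t / (\<delta> / 2)\<rfloor> + 1"
      using t assms(3) by (simp add: k_def)
    have "t / (\<delta> / 2) < real k" "real k \<le> t / (\<delta> / 2) + 1"
      unfolding k by linarith+
    then have "t < real k * (\<delta> / 2)" "real k * (\<delta> / 2) \<le> t + \<delta> / 2"
      using assms(3) by (auto simp: field_simps)
    moreover have "real (Suc k) * (\<delta> / 2) = real k * (\<delta> / 2) + \<delta> / 2"
      by (simp add: algebra_simps)
    ultimately have "t < \<tau> k" "\<tau> k < t + \<delta>"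
      using \<tau>(1)[of k] \<tau>(2)[of k] by linarith+
    moreover have "k \<le> nat \<lfloor>R / (\<delta> / 2)\<rfloor> + 1"
      unfolding k_def using t assms(3)
      by (intro add_right_mono nat_mono floor_mono divide_right_mono) auto
    ultimately show ?thesis by blast
  qed
  note grid = this
  have "\<forall>\<^sub>F m in F. \<forall>k\<in>{..nat \<lfloor>R / (\<delta> / 2)\<rfloor> + 1}. dist (h m (\<tau> k)) (g (\<tau> k)) < \<delta>"
    using \<tau>(3) assms(3) by (intro eventually_ball_finite) (auto dest: tendstoD)
  with assms(2) show ?thesis
  proof eventually_elim
    case (elim m)
    show ?case
    proof
      fix t assume "t \<in> {0..R}"
      then obtain k where k: "k \<le> nat \<lfloor>R / (\<delta> / 2)\<rfloor> + 1" "t < \<tau> k" "\<tau> k < t + \<delta>"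
        using grid by blast
      have "dist (h m (\<tau> k)) (g (\<tau> k)) < \<delta>" using elim k by blast
      moreover have "h m (t + \<delta>) \<le> h m (\<tau> k)" "h m (\<tau> k) \<le> h m t"
        using k by (intro antimonoD[OF elim(1)]; simp)+
      moreover have "g (t + \<delta>) \<le> g (\<tau> k)" "g (\<tau> k) \<le> g t"
        using k by (intro antimonoD[OF assms(1)]; simp)+
      ultimately show "h m (t + \<delta>) \<le> g t + \<delta> \<and> g (t + \<delta>) \<le> h m t + \<delta>"
        by (auto simp: dist_real_def)
    qed
  qed
qed

lemma dM1_inf_tendsto_0:
  fixes g :: "real \<Rightarrow> real" and h :: "'m \<Rightarrow> real \<Rightarrow> real"
  assumes g: "cadlag g" "antimono g" "range g \<subseteq> {0..1}"
    and h: "\<forall>\<^sub>F m in F. cadlag (h m) \<and> antimono (h m) \<and> range (h m) \<subseteq> {0..1}"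
    and zero: "((\<lambda>m. h m 0) \<longlongrightarrow> g 0) F"
    and dense: "\<And>a b. 0 \<le> a \<Longrightarrow> a < b \<Longrightarrow> \<exists>t. a < t \<and> t < b \<and> ((\<lambda>m. h m t) \<longlongrightarrow> g t) F"
  shows "((\<lambda>m. dM1_inf g (h m)) \<longlongrightarrow> 0) F"
proof (rule order_tendstoI)
  fix e :: ennreal assume "0 < e"
  then obtain x where x: "0 < x" "x < e" using Orderings.dense by blast
  then obtain e' where e': "0 < e'" "ennreal e' < e"
    by (cases x) auto
  \<comment> \<open>With these choices \<open>11 * \<delta>\<close> and \<open>exp (- R)\<close> are
    each half of \<open>e'\<close>.\<close>
  define \<delta> where "\<delta> = e' / 22"
  define R where "R = - ln (e' / 2)"
  have \<delta>: "0 < \<delta>" "11 * \<delta> + exp (- R) = e'"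
    using e' by (simp_all add: \<delta>_def R_def)
  have "\<forall>\<^sub>F m in F. \<forall>t\<in>{0..R}. h m (t + \<delta>) \<le> g t + \<delta> \<and> g (t + \<delta>) \<le> h m t + \<delta>"
    using h by (intro eventually_close g dense \<delta>) (auto elim: eventually_mono)
  moreover have "\<forall>\<^sub>F m in F. dist (h m 0) (g 0) < \<delta>"
    using zero \<delta> by (auto dest: tendstoD)
  ultimately show "\<forall>\<^sub>F m in F. dM1_inf g (h m) < e"
    using h
  proof eventually_elim
    case (elim m)
    have "dM1_inf g (h m) \<le> ennreal (11 * \<delta> + exp (- R))"
      using elim \<delta> by (intro dM1_inf_le g) (auto simp: dist_real_def)
    with \<delta> e' show ?case by simp
  qed
qed simp


section \<open>The maps as functions of the set of atoms\<close>

definition inf_below :: "(real \<times> real) set \<Rightarrow> real \<Rightarrow> ennreal" where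
  "inf_below A t = (INF p \<in> {p \<in> A. fst p \<le> t}. ennreal (snd p))"

definition profile :: "(real \<times> real) set \<Rightarrow> real \<Rightarrow> ennreal" where
  "profile A t = (if (INF p \<in> A. ennreal (fst p)) < ennreal t then inf_below A t
     else SUP s \<in> {s. (INF p \<in> A. ennreal (fst p)) < ennreal s}. inf_below A s)"

text \<open>The trace of the Radon property on the set of atoms: each compact subset of the quadrant
  lies in such a rectangle.\<close>

definition quadrant_discrete :: "(real \<times> real) set \<Rightarrow> bool" where
  "quadrant_discrete A \<longleftrightarrow> A \<subseteq> quadrant \<and> (\<forall>a b. finite (A \<inter> {0..a} \<times> {0..b}))"

lemma h1_eq_profile: "h1 m = profile (atoms m)"
  by (rule ext) (simp add: h1_def profile_def t_low_def inf_y_def y_top_def inf_below_def)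

section \<open>One-sided limits of decreasing functions and regularity of profiles\<close>

lemma antimono_tendsto_at_right:
  fixes f :: "real \<Rightarrow> 'b::{complete_linorder, linorder_topology}"
  assumes "antimono f"
  shows "(f \<longlongrightarrow> (SUP s\<in>{t<..}. f s)) (at_right t)"
proof (rule order_tendstoI)
  fix a assume "a < (SUP s\<in>{t<..}. f s)"
  then obtain s where s: "t < s" "a < f s" by (auto simp: less_SUP_iff)
  then have "a < f u" if "u < s" for u
    using antimonoD[OF assms, of u s] that by auto
  then show "\<forall>\<^sub>F u in at_right t. a < f u"
    unfolding eventually_at_right_field using s by blast
next
  fix a assume a: "(SUP s\<in>{t<..}. f s) < a"
  then have "f u < a" if "t < u" for u
    using that by (meson SUP_upper greaterThan_iff le_less_trans)
  then show "\<forall>\<^sub>F u in at_right t. f u < a"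
    unfolding eventually_at_right_field by (auto intro: exI[of _ "t + 1"])
qed

lemma antimono_tendsto_at_left:
  fixes f :: "real \<Rightarrow> 'b::{complete_linorder, linorder_topology}"
  assumes "antimono f"
  shows "(f \<longlongrightarrow> (INF s\<in>{..<t}. f s)) (at_left t)"
proof (rule order_tendstoI)
  fix a assume "(INF s\<in>{..<t}. f s) < a"
  then obtain s where s: "s < t" "f s < a" by (auto simp: INF_less_iff)
  then have "f u < a" if "s < u" for u
    using antimonoD[OF assms, of s u] that by auto
  then show "\<forall>\<^sub>F u in at_left t. f u < a"
    unfolding eventually_at_left_field using s by blast
next
  fix a assume a: "a < (INF s\<in>{..<t}. f s)"
  then have "a < f u" if "u < t" for u
    using that by (meson INF_lower lessThan_iff less_le_trans)
  then show "\<forall>\<^sub>F u in at_left t. a < f u"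
    unfolding eventually_at_left_field by (auto intro: exI[of _ "t - 1"])
qed

text \<open>This turns the suprema in \<open>y_top\<close> and \<open>t_top\<close> into right
  limits at the infimal coordinate.\<close>

lemma SUP_antimono_eq_limit:
  fixes f :: "real \<Rightarrow> 'b::{complete_linorder, linorder_topology}"
  assumes "antimono f" "(f \<longlongrightarrow> l) (at_right t)"
  shows "(SUP s\<in>{t<..}. f s) = l"
  using antimono_tendsto_at_right[OF assms(1)] assms(2)
  by (rule tendsto_unique[rotated]) simp

lemma inf_below_antimono: "antimono (inf_below A)"
  unfolding inf_below_def by (auto simp: monotone_on_def intro!: INF_superset_mono)

lemma le_inf_below:
  assumes "\<And>p. p \<in> A \<Longrightarrow> fst p \<le> t \<Longrightarrow> c \<le> ennreal (snd p)"
  shows "c \<le> inf_below A t"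
  unfolding inf_below_def using assms by (auto intro!: INF_greatest)

lemma inf_below_le: "p \<in> A \<Longrightarrow> fst p \<le> t \<Longrightarrow> inf_below A t \<le> ennreal (snd p)"
  unfolding inf_below_def by (auto intro!: INF_lower)

lemma ennreal_dense_real:
  assumes "a < (b :: ennreal)"
  obtains r where "0 \<le> r" "a < ennreal r" "ennreal r < b"
proof -
  obtain c where "a < c" "c < b" using dense[OF assms] by blast
  then show thesis by (cases c) (auto intro: that)
qed

text \<open>Only finitely many atoms of height at most r have a time up to t + 1, so after t some
  time passes before the first new one appears; until then the infimum stays at least r.\<close>

lemma inf_below_right_continuous:
  assumes "quadrant_discrete A"
  shows "(inf_below A \<longlongrightarrow> inf_below A t) (at_right t)"
proof (rule order_tendstoI)
  fix a assume "inf_below A t < a"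
  then have "inf_below A u < a" if "t < u" for u
    using antimonoD[OF inf_below_antimono, of t u A] that by auto
  then show "\<forall>\<^sub>F u in at_right t. inf_below A u < a"
    unfolding eventually_at_right_field by (auto intro: exI[of _ "t + 1"])
next
  fix a assume "a < inf_below A t"
  then obtain r where r: "0 \<le> r" "a < ennreal r" "ennreal r < inf_below A t"
    by (rule ennreal_dense_real)
  let ?F = "fst ` (A \<inter> {0..t + 1} \<times> {0..r}) \<inter> {t<..}"
  \<comment> \<open>The inserted \<open>t + 1\<close> keeps \<open>Min\<close> defined when no such
    atom exists.\<close>
  define b where "b = Min (insert (t + 1) ?F)"
  have fin: "finite ?F" using assms by (auto simp: quadrant_discrete_def)
  then have b: "t < b" "b \<le> t + 1" "\<And>x. x \<in> ?F \<Longrightarrow> b \<le> x"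
    by (auto simp: b_def)
  have "ennreal r \<le> inf_below A u" if u: "t < u" "u < b" for u
  proof (rule le_inf_below)
    fix p assume p: "p \<in> A" "fst p \<le> u"
    show "ennreal r \<le> ennreal (snd p)"
    proof (cases "fst p \<le> t")
      case True
      with inf_below_le[OF p(1) True] r(3) show ?thesis by simp
    next
      case False
      have "r < snd p"
      proof (rule ccontr)
        assume "\<not> r < snd p"
        moreover have "p \<in> quadrant" using p(1) assms by (auto simp: quadrant_discrete_def)
        ultimately have "fst p \<in> ?F"
          using p u b(2) False by (intro IntI image_eqI[of _ _ p]) (auto simp: quadrant_def)
        from b(3)[OF this] p u show False by simp
      qed
      then show ?thesis by (simp add: ennreal_leI)
    qed
  qed
  then show "\<forall>\<^sub>F u in at_right t. a < inf_below A u"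
    unfolding eventually_at_right_field using b(1) r(2) by (meson less_le_trans)
qed

text \<open>\<open>ennreal\<close> sends negative times to 0, and \<open>t0\<close> is nonnegative,
  so comparison in \<open>ennreal\<close> agrees with comparison of reals for every
  \<open>t\<close>.\<close>

lemma first_coordinate_INF:
  assumes "A \<noteq> {}"
  obtains t0 where "0 \<le> t0" "(INF p \<in> A. ennreal (fst p)) = ennreal t0"
    "\<And>t. (INF p \<in> A. ennreal (fst p)) < ennreal t \<longleftrightarrow> t0 < t"
proof -
  obtain p where "p \<in> A" using assms by blast
  then have "(INF p \<in> A. ennreal (fst p)) \<le> ennreal (fst p)" by (rule INF_lower)
  then have "(INF p \<in> A. ennreal (fst p)) < \<infinity>" by (rule le_less_trans) simp
  then obtain t0 where "0 \<le> t0" "(INF p \<in> A. ennreal (fst p)) = ennreal t0"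
    by (cases "INF p \<in> A. ennreal (fst p)") auto
  then show thesis by (intro that[of t0]) (auto simp: ennreal_less_iff)
qed

lemma profile_eq:
  assumes "quadrant_discrete A" "A \<noteq> {}"
  obtains t0 where "0 \<le> t0" "(INF p \<in> A. ennreal (fst p)) = ennreal t0"
    "\<And>t. profile A t = inf_below A (max t t0)"
proof -
  obtain t0 where t0: "0 \<le> t0" "(INF p \<in> A. ennreal (fst p)) = ennreal t0"
    "\<And>t. (INF p \<in> A. ennreal (fst p)) < ennreal t \<longleftrightarrow> t0 < t"
    using first_coordinate_INF[OF assms(2)] by metis
  have "(SUP s\<in>{t0<..}. inf_below A s) = inf_below A t0"
    by (intro SUP_antimono_eq_limit inf_below_antimono inf_below_right_continuous assms)
  moreover have "{s. t0 < s} = {t0<..}" by auto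
  ultimately have "profile A t = inf_below A (max t t0)" for t
    by (simp add: profile_def t0(3) max_def)
  then show thesis using t0 by (intro that) auto
qed

text \<open>The infimum of no times is \<infinity>, so no time exceeds it and the supremum in
  \<open>profile\<close> is over the empty set.\<close>

lemma profile_empty: "profile {} = (\<lambda>_. 0)"
  by (rule ext) (simp add: profile_def bot_ennreal)

lemma profile_antimono:
  assumes "quadrant_discrete A"
  shows "antimono (profile A)"
proof (cases "A = {}")
  case False
  then obtain t0 where "\<And>t. profile A t = inf_below A (max t t0)"
    using profile_eq[OF assms] by metis
  then show ?thesis
    by (auto simp: monotone_on_def intro!: antimonoD[OF inf_below_antimono])
qed (simp add: profile_empty monotone_on_def)

lemma tendsto_at_right_max:
  fixes f :: "real \<Rightarrow> 'b::topological_space"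
  assumes "\<And>t. (f \<longlongrightarrow> f t) (at_right t)"
  shows "((\<lambda>s. f (max s t0)) \<longlongrightarrow> f (max t t0)) (at_right t)"
proof (cases "t < t0")
  case True
  then have "\<forall>\<^sub>F s in at_right t. f (max s t0) = f (max t t0)"
    unfolding eventually_at_right_field by (intro exI[of _ t0]) auto
  then show ?thesis by (rule tendsto_eventually)
next
  case False
  then have "\<forall>\<^sub>F s in at_right t. f s = f (max s t0)"
    unfolding eventually_at_right_field by (intro exI[of _ "t + 1"]) auto
  with assms[of t] False show ?thesis
    by (auto intro: Lim_transform_eventually)
qed

lemma profile_cadlag:
  assumes "quadrant_discrete A"
  shows "cadlag (profile A)"
proof (cases "A = {}")
  case False
  then obtain t0 where t0: "profile A = (\<lambda>t. inf_below A (max t t0))"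
    using profile_eq[OF assms] by (metis ext)
  show ?thesis
    unfolding cadlag_def
  proof (intro conjI allI impI)
    show "(profile A \<longlongrightarrow> profile A t) (at_right t)" for t
      unfolding t0 by (rule tendsto_at_right_max inf_below_right_continuous assms)+
    show "\<exists>l. (profile A \<longlongrightarrow> l) (at_left t)" for t
      using antimono_tendsto_at_left[OF profile_antimono[OF assms]] by blast
  qed
qed (auto simp: profile_empty cadlag_def intro: exI[of _ 0])

lemma quadrant_discrete_swap:
  assumes "quadrant_discrete A"
  shows "quadrant_discrete (prod.swap ` A)"
proof -
  have "prod.swap ` A \<inter> {0..a} \<times> {0..b} = prod.swap ` (A \<inter> {0..b} \<times> {0..a})" for a b
    by auto
  with assms show ?thesis by (auto simp: quadrant_discrete_def quadrant_def)
qed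

lemma quadrant_discrete_countable:
  assumes "quadrant_discrete A"
  shows "countable A"
proof (rule countable_subset)
  show "A \<subseteq> (\<Union>n::nat. A \<inter> {0..real n} \<times> {0..real n})"
  proof
    fix p assume p: "p \<in> A"
    obtain n :: nat where "max (fst p) (snd p) \<le> real n" using real_arch_simple by blast
    then have "p \<in> {0..real n} \<times> {0..real n}"
      using p assms by (cases p) (auto simp: quadrant_def quadrant_discrete_def)
    with p show "p \<in> (\<Union>n::nat. A \<inter> {0..real n} \<times> {0..real n})" by blast
  qed
  show "countable (\<Union>n::nat. A \<inter> {0..real n} \<times> {0..real n})"
    using assms by (intro countable_UN countableI_type countable_finite) (auto simp: quadrant_discrete_def)
qed

text \<open>For s > t the infimum over times strictly before s is squeezed between
  \<open>inf_below A s\<close> and \<open>inf_below A t\<close>. This is how the strict inequality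
  in \<open>inf_t\<close> disappears in the right limit.\<close>

lemma inf_strictly_below_tendsto:
  assumes "quadrant_discrete A"
  shows "((\<lambda>s. INF p \<in> {p \<in> A. fst p < s}. ennreal (snd p)) \<longlongrightarrow> inf_below A t) (at_right t)"
proof (rule tendsto_sandwich[OF _ _ inf_below_right_continuous[OF assms] tendsto_const])
  show "\<forall>\<^sub>F s in at_right t. inf_below A s \<le> (INF p \<in> {p \<in> A. fst p < s}. ennreal (snd p))"
    unfolding inf_below_def by (intro always_eventually allI INF_superset_mono) auto
  show "\<forall>\<^sub>F s in at_right t. (INF p \<in> {p \<in> A. fst p < s}. ennreal (snd p)) \<le> inf_below A t"
    unfolding eventually_at_right_field inf_below_def
    by (intro exI[of _ "t + 1"]) (auto intro!: INF_superset_mono)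
qed

text \<open>From the infimal height \<open>t0\<close> on, the values of \<open>h2 m\<close> to the
  right are strict infima with the limit just computed. Below \<open>t0\<close>, \<open>h2 m\<close>
  is locally the constant \<open>t_top m\<close>, itself such a right limit at
  \<open>t0\<close>.\<close>

lemma right_version_h2_eq_profile:
  assumes "quadrant_discrete (atoms m)"
  shows "right_version (h2 m) = profile (prod.swap ` atoms m)"
proof
  fix y
  let ?B = "prod.swap ` atoms m"
  let ?J = "\<lambda>s. INF p \<in> {p \<in> ?B. fst p < s}. ennreal (snd p)"
  have B: "quadrant_discrete ?B" by (rule quadrant_discrete_swap[OF assms])
  have "{p \<in> ?B. fst p < s} = prod.swap ` {p \<in> atoms m. snd p < s}" for s by auto
  then have J: "inf_t m s = ?J s" for s
    by (simp add: inf_t_def image_image)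
  have low: "y_low m = (INF p \<in> ?B. ennreal (fst p))"
    by (simp add: y_low_def image_image)
  have "(h2 m \<longlongrightarrow> profile ?B y) (at_right y)"
  proof (cases "?B = {}")
    case True
    then have "h2 m s = 0" for s
      by (simp add: h2_def t_top_def y_low_def bot_ennreal)
    then have "h2 m = (\<lambda>_. 0)" by (rule ext)
    with True show ?thesis by (simp add: profile_empty)
  next
    case False
    obtain t0 where t0: "0 \<le> t0" "(INF p \<in> ?B. ennreal (fst p)) = ennreal t0"
      "\<And>t. profile ?B t = inf_below ?B (max t t0)"
      using profile_eq[OF B False] by metis
    have pos: "y_low m < ennreal s \<longleftrightarrow> t0 < s" for s
      using t0 by (simp add: low ennreal_less_iff)
    have "antimono ?J" by (auto simp: monotone_on_def intro!: INF_superset_mono)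
    then have "(SUP s\<in>{t0<..}. ?J s) = inf_below ?B t0"
      by (intro SUP_antimono_eq_limit inf_strictly_below_tendsto B)
    moreover have "{s. t0 < s} = {t0<..}" by auto
    ultimately have top: "t_top m = inf_below ?B t0"
      by (simp add: t_top_def pos J)
    show ?thesis
    proof (cases "t0 \<le> y")
      case True
      then have "\<forall>\<^sub>F s in at_right y. ?J s = h2 m s"
        unfolding eventually_at_right_field by (intro exI[of _ "y + 1"]) (auto simp: h2_def pos J)
      with inf_strictly_below_tendsto[OF B] have "(h2 m \<longlongrightarrow> inf_below ?B y) (at_right y)"
        by (rule Lim_transform_eventually)
      with True show ?thesis by (simp add: t0(3))
    next
      case False
      then have "\<forall>\<^sub>F s in at_right y. h2 m s = profile ?B y"
        unfolding eventually_at_right_field by (intro exI[of _ t0]) (auto simp: h2_def pos t0(3) top)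
      then show ?thesis by (rule tendsto_eventually)
    qed
  qed
  then show "right_version (h2 m) y = profile ?B y"
    unfolding right_version_def by (intro tendsto_Lim) auto
qed

section \<open>Transport of values to the unit interval\<close>

lemma inverse_ennreal_antimono: "x \<le> y \<Longrightarrow> inverse y \<le> inverse (x :: ennreal)"
  by (auto simp: less_eq_ennreal.rep_eq inverse_ennreal.rep_eq intro!: ereal_inverse_antimono)

lemma inverse_one_plus_le: "inverse (1 + x) \<le> (1 :: ennreal)"
  using inverse_ennreal_antimono[of 1 "1 + x"] by simp

lemma squash_mem: "squash x \<in> {0..1}"
proof -
  have "enn2real (inverse (1 + x)) \<le> 1" using inverse_one_plus_le[of x] by (intro enn2real_leI) auto
  then show ?thesis by (simp add: squash_def)
qed

lemma squash_mono: "mono squash"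
proof
  fix x y :: ennreal assume "x \<le> y"
  then have "inverse (1 + y) \<le> inverse (1 + x)" by (intro inverse_ennreal_antimono add_left_mono)
  moreover have "inverse (1 + x) < top"
    using inverse_one_plus_le by (rule le_less_trans) simp
  ultimately show "squash x \<le> squash y"
    by (simp add: squash_def enn2real_mono)
qed

lemma tendsto_squash:
  assumes "(f \<longlongrightarrow> l) F"
  shows "((\<lambda>x. squash (f x)) \<longlongrightarrow> squash l) F"
proof -
  have inverse_cont: "continuous_on UNIV (inverse :: ennreal \<Rightarrow> ennreal)"
    by (intro continuous_on_inverse_ennreal continuous_on_id)
  have "((\<lambda>x. inverse (1 + f x)) \<longlongrightarrow> inverse (1 + l)) F"
    by (intro continuous_on_tendsto_compose[OF inverse_cont] tendsto_add tendsto_const assms) auto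
  \<comment> \<open>\<open>enn2real\<close> is discontinuous at \<open>top\<close>, so finiteness of
    the limit has to be known.\<close>
  moreover have "inverse (1 + l) < top"
    using inverse_one_plus_le by (rule le_less_trans) simp
  ultimately have "((\<lambda>x. inverse (1 + f x)) \<longlongrightarrow> ennreal (enn2real (inverse (1 + l)))) F"
    by (simp only: ennreal_enn2real)
  then have "((\<lambda>x. enn2real (inverse (1 + f x))) \<longlongrightarrow> enn2real (inverse (1 + l))) F"
    by (rule tendsto_enn2real) simp
  then show ?thesis unfolding squash_def by (rule tendsto_diff[OF tendsto_const])
qed

lemma squash_profile:
  assumes "quadrant_discrete A"
  shows "cadlag (squash \<circ> profile A)" "antimono (squash \<circ> profile A)"
    "range (squash \<circ> profile A) \<subseteq> {0..1}"
proof -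
  show "cadlag (squash \<circ> profile A)"
    using profile_cadlag[OF assms] unfolding cadlag_def comp_def by (blast intro: tendsto_squash)
  show "antimono (squash \<circ> profile A)"
    using profile_antimono[OF assms] squash_mono by (auto simp: monotone_on_def)
  show "range (squash \<circ> profile A) \<subseteq> {0..1}"
    using squash_mem by auto
qed

section \<open>Convergence of profiles under convergence of atoms\<close>

text \<open>The two halves of convergence in the Fell topology of closed sets, for rectangles only.\<close>

definition hit_miss_limit :: "('m \<Rightarrow> (real \<times> real) set) \<Rightarrow> (real \<times> real) set \<Rightarrow> 'm filter \<Rightarrow> bool" where
  "hit_miss_limit A B F \<longleftrightarrow>
    (\<forall>p\<in>B. \<forall>r>0. \<forall>\<^sub>F m in F. A m \<inter> ball p r \<noteq> {}) \<and>
    (\<forall>a b. B \<inter> {0..a} \<times> {0..b} = {} \<longrightarrow> (\<forall>\<^sub>F m in F. A m \<inter> {0..a} \<times> {0..b} = {}))"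

text \<open>The product metric is symmetric in the two coordinates, so balls are exchanged with
  balls and rectangles with rectangles.\<close>

lemma hit_miss_limit_swap:
  assumes "hit_miss_limit A B F"
  shows "hit_miss_limit (\<lambda>m. prod.swap ` A m) (prod.swap ` B) F"
proof -
  have rect: "prod.swap ` A \<inter> {0..a} \<times> {0..b} = prod.swap ` (A \<inter> {0..b} \<times> {0..a})"
    for A :: "(real \<times> real) set" and a b
    by auto
  have ball: "prod.swap ` A \<inter> ball (prod.swap p) r = prod.swap ` (A \<inter> ball p r)"
    for A :: "(real \<times> real) set" and p r
    by (auto simp: dist_prod_def add.commute)
  show ?thesis
    using assms by (simp add: hit_miss_limit_def rect ball)
qed

text \<open>Only the limit \<open>B\<close> is asked to have positive times accumulating at 0; the
  approximating sets are merely discrete. \<open>pos\<close> makes the limit profile infinite at 0,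
  and \<open>small\<close> makes every t > 0 exceed the infimal time of the nearby sets.\<close>

locale vanishing_limit =
  fixes A :: "'m \<Rightarrow> (real \<times> real) set" and B :: "(real \<times> real) set" and F :: "'m filter"
  assumes lim: "hit_miss_limit A B F"
    and discrete: "\<forall>\<^sub>F m in F. quadrant_discrete (A m)" "quadrant_discrete B"
    and pos: "\<And>p. p \<in> B \<Longrightarrow> 0 < fst p"
    and small: "\<And>e. 0 < e \<Longrightarrow> \<exists>p\<in>B. fst p < e"
begin

lemma INF_zero: "(INF p \<in> B. ennreal (fst p)) = 0"
proof (rule antisym[OF ennreal_le_epsilon])
  fix e :: real assume "0 < e"
  then obtain p where "p \<in> B" "fst p < e" using small by blast
  then show "(INF p \<in> B. ennreal (fst p)) \<le> 0 + ennreal e"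
    by (auto intro!: INF_lower2[of p] ennreal_leI)
qed simp

lemma profile_limit_eq: "profile B t = inf_below B (max t 0)"
proof -
  have "B \<noteq> {}" using small[of 1] by auto
  then obtain t0 where "0 \<le> t0" "(INF p \<in> B. ennreal (fst p)) = ennreal t0"
    "\<And>t. profile B t = inf_below B (max t t0)"
    using profile_eq[OF discrete(2)] by metis
  with INF_zero show ?thesis by (auto simp: ennreal_eq_0_iff)
qed

lemma eventually_hit:
  assumes "p \<in> B" "open S" "p \<in> S"
  shows "\<forall>\<^sub>F m in F. \<exists>q\<in>A m. q \<in> S"
proof -
  obtain r where r: "0 < r" "ball p r \<subseteq> S"
    using assms(2,3) open_contains_ball by blast
  then have "\<forall>\<^sub>F m in F. A m \<inter> ball p r \<noteq> {}"
    using lim assms(1) by (auto simp: hit_miss_limit_def)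
  then show ?thesis
    by (rule eventually_mono) (use r in blast)
qed

text \<open>An atom of \<open>B\<close> before \<open>t\<close> forces an atom of \<open>A m\<close>
  before \<open>t\<close>, so \<open>t\<close> falls into the first case of
  \<open>profile\<close>.\<close>

lemma eventually_profile_eq:
  assumes "0 < t"
  shows "\<forall>\<^sub>F m in F. profile (A m) t = inf_below (A m) t"
proof -
  obtain p where p: "p \<in> B" "fst p < t" using small[OF assms] by blast
  have "open {q :: real \<times> real. fst q < t}" by (intro open_Collect_less continuous_intros)
  then have "\<forall>\<^sub>F m in F. \<exists>q\<in>A m. q \<in> {q. fst q < t}"
    using p by (intro eventually_hit) auto
  then show ?thesis
  proof (rule eventually_mono)
    fix m assume "\<exists>q\<in>A m. q \<in> {q. fst q < t}"
    then obtain q where "q \<in> A m" "fst q < t" by blast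
    then have "(INF p \<in> A m. ennreal (fst p)) < ennreal t"
      using assms by (auto simp: INF_less_iff intro!: bexI[of _ q] ennreal_lessI)
    then show "profile (A m) t = inf_below (A m) t" by (simp add: profile_def)
  qed
qed

text \<open>An upper bound comes from hitting: an atom of \<open>B\<close> that witnesses it has an
  atom of \<open>A m\<close> nearby. A lower bound comes from missing: a rectangle without points of
  \<open>B\<close> eventually has no points of \<open>A m\<close>.\<close>

lemma profile_tendsto:
  assumes "0 < t" "t \<notin> fst ` B"
  shows "((\<lambda>m. profile (A m) t) \<longlongrightarrow> profile B t) F"
proof -
  have "((\<lambda>m. inf_below (A m) t) \<longlongrightarrow> inf_below B t) F"
  proof (rule order_tendstoI)
    fix c assume "inf_below B t < c"
    then obtain p where p: "p \<in> B" "fst p \<le> t" "ennreal (snd p) < c"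
      by (auto simp: inf_below_def INF_less_iff)
    \<comment> \<open>An atom at time exactly \<open>t\<close> could be approximated by later atoms,
      which \<open>inf_below (A m) t\<close> ignores.\<close>
    moreover have "fst p \<noteq> t" using p assms by auto
    moreover have "open {q :: real \<times> real. fst q < t \<and> ennreal (snd q) < c}"
      by (intro open_Collect_conj open_Collect_less continuous_on_ennreal continuous_intros)
    ultimately have "\<forall>\<^sub>F m in F. \<exists>q\<in>A m. q \<in> {q. fst q < t \<and> ennreal (snd q) < c}"
      by (intro eventually_hit) auto
    then show "\<forall>\<^sub>F m in F. inf_below (A m) t < c"
    proof (rule eventually_mono)
      fix m assume "\<exists>q\<in>A m. q \<in> {q. fst q < t \<and> ennreal (snd q) < c}"
      then obtain q where "q \<in> A m" "fst q < t" "ennreal (snd q) < c" by blast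
      then show "inf_below (A m) t < c"
        using inf_below_le[of q "A m" t] by (auto intro: le_less_trans)
    qed
  next
    fix c assume "c < inf_below B t"
    then obtain r where r: "0 \<le> r" "c < ennreal r" "ennreal r < inf_below B t"
      by (rule ennreal_dense_real)
    have "B \<inter> {0..t} \<times> {0..r} = {}"
    proof -
      have False if "p \<in> B" "fst p \<le> t" "snd p \<le> r" for p
        using inf_below_le[OF that(1,2)] r(3) ennreal_leI[OF that(3)] by simp
      then show ?thesis by force
    qed
    then have "\<forall>\<^sub>F m in F. A m \<inter> {0..t} \<times> {0..r} = {}"
      using lim by (auto simp: hit_miss_limit_def)
    with discrete(1) show "\<forall>\<^sub>F m in F. c < inf_below (A m) t"
    proof eventually_elim
      case (elim m)
      have "ennreal r \<le> inf_below (A m) t"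
      proof (rule le_inf_below)
        fix p assume p: "p \<in> A m" "fst p \<le> t"
        then have "p \<in> quadrant" "p \<notin> {0..t} \<times> {0..r}"
          using elim by (auto simp: quadrant_discrete_def)
        with p show "ennreal r \<le> ennreal (snd p)"
          by (cases p) (auto simp: quadrant_def intro!: ennreal_leI)
      qed
      with r show ?case by simp
    qed
  qed
  then have "((\<lambda>m. profile (A m) t) \<longlongrightarrow> inf_below B t) F"
    by (rule Lim_transform_eventually)
       (use eventually_profile_eq[OF assms(1)] in \<open>auto elim: eventually_mono\<close>)
  then show ?thesis using assms by (simp add: profile_limit_eq)
qed

text \<open>\<open>B\<close> is countable, so its times cannot exhaust an interval.\<close>

lemma exists_convergence_point:
  assumes "0 \<le> a" "a < b"
  shows "\<exists>t. a < t \<and> t < b \<and> ((\<lambda>m. profile (A m) t) \<longlongrightarrow> profile B t) F"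
proof -
  have "countable B" by (rule quadrant_discrete_countable[OF discrete(2)])
  then have "countable (fst ` B)" by (rule countable_image)
  moreover have "uncountable {a<..<b}" using assms by (simp add: uncountable_open_interval)
  ultimately have "\<not> {a<..<b} \<subseteq> fst ` B" using countable_subset by metis
  then obtain t where "t \<in> {a<..<b}" "t \<notin> fst ` B" by blast
  then show ?thesis using assms by (intro exI[of _ t]) (auto intro!: profile_tendsto)
qed

text \<open>The limit is \<open>top\<close>, so only lower bounds matter. They hold for
  \<open>profile B\<close> at small t > 0, pass to \<open>A m\<close> at a convergence point, and
  increase on going back to 0. Atoms of \<open>A m\<close> at time 0 are harmless: they must be
  high.\<close>

lemma profile_tendsto_0: "((\<lambda>m. profile (A m) 0) \<longlongrightarrow> profile B 0) F"
proof (rule order_tendstoI)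
  have "\<not> fst p \<le> 0" if "p \<in> B" for p
    using pos[OF that] by simp
  then have none: "{p \<in> B. fst p \<le> 0} = {}" by blast
  have "inf_below B 0 = top" unfolding inf_below_def none by simp
  then have top: "profile B 0 = top" by (simp add: profile_limit_eq)
  show "\<forall>\<^sub>F m in F. profile (A m) 0 < c" if "profile B 0 < c" for c
    using that by (simp add: top)
  fix c assume "c < profile B 0"
  moreover have "(profile B \<longlongrightarrow> profile B 0) (at_right 0)"
    using profile_cadlag[OF discrete(2)] by (auto simp: cadlag_def)
  ultimately have "\<forall>\<^sub>F t in at_right 0. c < profile B t"
    by (intro order_tendstoD)
  then obtain b where b: "0 < b" "\<And>t. 0 < t \<Longrightarrow> t < b \<Longrightarrow> c < profile B t"
    unfolding eventually_at_right_field by blast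
  obtain t where t: "0 < t" "t < b" "((\<lambda>m. profile (A m) t) \<longlongrightarrow> profile B t) F"
    using exists_convergence_point[of 0 b] b by blast
  have "\<forall>\<^sub>F m in F. c < profile (A m) t"
    using t b(2)[OF t(1,2)] by (intro order_tendstoD)
  with discrete(1) show "\<forall>\<^sub>F m in F. c < profile (A m) 0"
  proof eventually_elim
    case (elim m)
    have "profile (A m) t \<le> profile (A m) 0"
      using elim t by (intro antimonoD[OF profile_antimono]) auto
    with elim(2) show ?case by simp
  qed
qed

lemma dM1_inf_profile_tendsto_0:
  "((\<lambda>m. dM1_inf (squash \<circ> profile B) (squash \<circ> profile (A m))) \<longlongrightarrow> 0) F"
proof (rule dM1_inf_tendsto_0)
  show "cadlag (squash \<circ> profile B)" "antimono (squash \<circ> profile B)"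
    "range (squash \<circ> profile B) \<subseteq> {0..1}"
    using squash_profile[OF discrete(2)] by blast+
  show "\<forall>\<^sub>F m in F. cadlag (squash \<circ> profile (A m)) \<and> antimono (squash \<circ> profile (A m)) \<and>
      range (squash \<circ> profile (A m)) \<subseteq> {0..1}"
    using discrete(1) by (rule eventually_mono) (intro conjI squash_profile)
  show "((\<lambda>m. (squash \<circ> profile (A m)) 0) \<longlongrightarrow> (squash \<circ> profile B) 0) F"
    unfolding comp_def by (intro tendsto_squash profile_tendsto_0)
  show "\<exists>t. a < t \<and> t < b \<and> ((\<lambda>m. (squash \<circ> profile (A m)) t) \<longlongrightarrow> (squash \<circ> profile B) t) F"
    if "0 \<le> a" "a < b" for a b
  proof -
    obtain t where "a < t" "t < b" "((\<lambda>m. profile (A m) t) \<longlongrightarrow> profile B t) F"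
      using exists_convergence_point[OF \<open>0 \<le> a\<close> \<open>a < b\<close>] by blast
    then show ?thesis
      unfolding comp_def by (intro exI[of _ t] conjI tendsto_squash)
  qed
qed

end


section \<open>Vague neighbourhoods\<close>

lemma space_dirac_sum [simp]: "space (dirac_sum S I x) = S"
  and sets_dirac_sum [simp]: "sets (dirac_sum S I x) = sets (restrict_space borel S)"
  by (simp_all add: dirac_sum_def space_restrict_space)

lemma emeasure_dirac_sum:
  assumes "x \<in> I \<rightarrow> S" "A \<in> sets (restrict_space borel S)"
  shows "emeasure (dirac_sum S I x) A = emeasure (count_space I) (x -` A \<inter> I)"
  unfolding dirac_sum_def using assms
  by (subst emeasure_distr) (auto simp: space_restrict_space measurable_count_space_eq1)

lemma singleton_in_restrict_borel:
  fixes p :: "'a::t1_space"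
  shows "p \<in> S \<Longrightarrow> {p} \<in> sets (restrict_space borel S)"
  by (auto simp: sets_restrict_space intro!: image_eqI[of _ _ "{p}"])

lemma atoms_dirac_sum:
  fixes x :: "'i \<Rightarrow> 'a::t1_space"
  assumes "x \<in> I \<rightarrow> S"
  shows "atoms (dirac_sum S I x) = x ` I"
proof -
  have "emeasure (dirac_sum S I x) {p} \<noteq> 0 \<longleftrightarrow> p \<in> x ` I" if "p \<in> S" for p
    using that by (auto simp: emeasure_dirac_sum[OF assms] singleton_in_restrict_borel
        emeasure_count_space_eq_0)
  with assms show ?thesis by (fastforce simp: atoms_def)
qed

lemma compact_in_restrict_borel:
  fixes C :: "'a::t2_space set"
  assumes "compact C" "C \<subseteq> S"
  shows "C \<in> sets (restrict_space borel S)"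
  using assms by (auto simp: sets_restrict_space compact_imp_closed intro!: image_eqI[of _ _ C])

lemma finite_preimage_compact:
  fixes x :: "'i \<Rightarrow> 'a::t2_space"
  assumes "x \<in> I \<rightarrow> S" "emeasure (dirac_sum S I x) C < \<infinity>" "compact C" "C \<subseteq> S"
  shows "finite (x -` C \<inter> I)"
  using assms by (auto simp: emeasure_dirac_sum[OF assms(1)] compact_in_restrict_borel
      emeasure_count_space split: if_splits)

text \<open>\<open>Mp\<close> asks for natural numbers as indices. The labels of the process are
  triples, so they are recoded by \<open>to_nat\<close>.\<close>

lemma dirac_sum_in_Mp:
  fixes x :: "'i::countable \<Rightarrow> 'a::t2_space"
  assumes x: "x \<in> I \<rightarrow> S" and fin: "\<And>C. compact C \<Longrightarrow> C \<subseteq> S \<Longrightarrow> finite (x -` C \<inter> I)"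
  shows "dirac_sum S I x \<in> Mp S"
proof -
  let ?J = "to_nat ` I" and ?y = "x \<circ> from_nat"
  have y: "?y \<in> ?J \<rightarrow> S" using x by auto
  have "dirac_sum S I x = dirac_sum S ?J ?y"
  proof (rule measure_eqI)
    fix A assume "A \<in> sets (dirac_sum S I x)"
    then have A: "A \<in> sets (restrict_space borel S)" by simp
    have "?y -` A \<inter> ?J = to_nat ` (x -` A \<inter> I)" by auto
    moreover have "card (to_nat ` (x -` A \<inter> I)) = card (x -` A \<inter> I)"
      "finite (to_nat ` (x -` A \<inter> I)) \<longleftrightarrow> finite (x -` A \<inter> I)"
      "to_nat ` (x -` A \<inter> I) \<subseteq> ?J"
      by (auto intro!: card_image finite_image_iff inj_on_subset[OF inj_to_nat])
    ultimately have "emeasure (count_space ?J) (?y -` A \<inter> ?J) = emeasure (count_space I) (x -` A \<inter> I)"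
      by (simp add: emeasure_count_space)
    then show "emeasure (dirac_sum S I x) A = emeasure (dirac_sum S ?J ?y) A"
      by (simp only: emeasure_dirac_sum[OF x A] emeasure_dirac_sum[OF y A])
  qed simp
  moreover have "emeasure (dirac_sum S I x) C < \<infinity>" if "compact C" "C \<subseteq> S" for C
    using fin[OF that] by (simp add: emeasure_dirac_sum[OF x] compact_in_restrict_borel that
        emeasure_count_space of_nat_less_top)
  ultimately show ?thesis unfolding Mp_def using y by blast
qed

context
  fixes S :: "'a::t2_space set" and m :: "'a measure"
  assumes m: "m \<in> Mp S"
begin

lemma Mp_dest:
  obtains I :: "nat set" and x where "x \<in> I \<rightarrow> S" "m = dirac_sum S I x" "atoms m = x ` I"
proof -
  obtain I :: "nat set" and x where "x \<in> I \<rightarrow> S" "m = dirac_sum S I x"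
    using m unfolding Mp_def by blast
  then show thesis using atoms_dirac_sum[of x I S] by (intro that) auto
qed

lemma space_Mp: "space m = S"
  and sets_Mp: "sets m = sets (restrict_space borel S)"
  using Mp_dest by (metis space_dirac_sum, metis sets_dirac_sum)

lemma atoms_Mp_subset: "atoms m \<subseteq> S"
  by (auto simp: atoms_def space_Mp)

lemma emeasure_Mp_compact: "compact C \<Longrightarrow> C \<subseteq> S \<Longrightarrow> emeasure m C < \<infinity>"
  using m by (auto simp: Mp_def)

lemma finite_atoms_compact:
  assumes "compact C" "C \<subseteq> S"
  shows "finite (atoms m \<inter> C)"
proof -
  obtain I :: "nat set" and x where x: "x \<in> I \<rightarrow> S" "m = dirac_sum S I x" "atoms m = x ` I"
    by (rule Mp_dest)
  have "finite (x -` C \<inter> I)"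
    using finite_preimage_compact[OF x(1)] emeasure_Mp_compact assms x(2) by auto
  then have "finite (x ` (x -` C \<inter> I))" by (rule finite_imageI)
  then show ?thesis unfolding x(3) by (rule rev_finite_subset) auto
qed

text \<open>Also used in contrapositive form: a nonzero integral of \<open>f\<close> exhibits an
  atom at which \<open>f\<close> does not vanish.\<close>

lemma integral_Mp_eq_0:
  fixes f :: "'a \<Rightarrow> real"
  assumes "\<And>p. p \<in> atoms m \<Longrightarrow> f p = 0" "f \<in> borel_measurable (restrict_space borel S)"
  shows "(\<integral>p. f p \<partial>m) = 0"
proof -
  obtain I :: "nat set" and x where x: "x \<in> I \<rightarrow> S" "m = dirac_sum S I x" "atoms m = x ` I"
    by (rule Mp_dest)
  have "(\<integral>p. f p \<partial>m) = (\<integral>i. f (x i) \<partial>count_space I)"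
    unfolding x(2) dirac_sum_def using assms(2) x(1)
    by (intro integral_distr) (auto simp: measurable_count_space_eq1 space_restrict_space)
  also have "\<dots> = (\<integral>i. 0 \<partial>count_space I)"
    using assms(1) x(3) by (intro Bochner_Integration.integral_cong) auto
  finally show ?thesis by simp
qed

text \<open>An atom of a point measure has mass at least 1, and \<open>f\<close> dominates the
  indicator of \<open>{p}\<close>.\<close>

lemma integral_Mp_ge_1:
  fixes f :: "'a \<Rightarrow> real"
  assumes f: "continuous_on S f" "\<And>p. 0 \<le> f p" "\<And>p. f p \<le> 1"
    and C: "compact C" "C \<subseteq> S" "\<And>p. p \<in> S - C \<Longrightarrow> f p = 0"
    and p: "p \<in> atoms m" "f p = 1"
  shows "1 \<le> (\<integral>p. f p \<partial>m)"
proof -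
  have meas: "f \<in> borel_measurable m"
    using borel_measurable_continuous_on_restrict[OF f(1)]
    by (simp add: measurable_cong_sets[OF sets_Mp refl])
  have p': "{p} \<in> sets m" "p \<in> S"
    using p atoms_Mp_subset singleton_in_restrict_borel[of p S] by (auto simp: sets_Mp)
  have CS: "C \<in> sets m" using C by (simp add: sets_Mp compact_in_restrict_borel)
  have "integrable m (indicator C :: 'a \<Rightarrow> real)"
    using CS emeasure_Mp_compact[OF C(1,2)] by (intro integrable_real_indicator) auto
  \<comment> \<open>A nonintegrable function would have Bochner integral 0. Integrability comes from
    the compact support, which has finite measure.\<close>
  then have int: "integrable m f"
    using f C by (rule_tac Bochner_Integration.integrable_bound[OF _ meas])
      (auto intro!: AE_I2 simp: space_Mp indicator_def)
  have "emeasure m {p} < \<infinity>"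
    using p' by (intro emeasure_Mp_compact) auto
  moreover have "1 \<le> emeasure m {p}"
  proof -
    obtain I :: "nat set" and x where x: "x \<in> I \<rightarrow> S" "m = dirac_sum S I x" "atoms m = x ` I"
      by (rule Mp_dest)
    obtain i where i: "i \<in> I" "x i = p" using p x by auto
    have "1 = emeasure (count_space I) {i}" using i by simp
    also have "\<dots> \<le> emeasure (count_space I) (x -` {p} \<inter> I)"
      using i by (intro emeasure_mono) auto
    also have "\<dots> = emeasure m {p}"
      using p' by (simp add: x(2) emeasure_dirac_sum[OF x(1)] singleton_in_restrict_borel)
    finally show ?thesis .
  qed
  ultimately have "1 \<le> measure m {p}"
    by (simp add: emeasure_eq_ennreal_measure)
  also have "measure m {p} = (\<integral>q. indicator {p} q \<partial>m)"
    using p' by simp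
  also have "\<dots> \<le> (\<integral>p. f p \<partial>m)"
  proof (rule integral_mono[OF _ int])
    show "integrable m (indicator {p} :: 'a \<Rightarrow> real)"
      using p' \<open>emeasure m {p} < \<infinity>\<close> by (intro integrable_real_indicator) auto
  qed (use f p in \<open>auto simp: indicator_def\<close>)
  finally show ?thesis .
qed

end

section \<open>Vague neighbourhoods hit balls around atoms and miss compact sets\<close>

lemma topspace_vague_topology [simp]: "topspace (vague_topology S) = Mp S"
proof -
  have "Mp S = {m \<in> Mp S. (\<integral>x. (0 :: real) \<partial>m) \<in> UNIV}" by simp
  then have "Mp S \<in> {{m \<in> Mp S. (\<integral>x. f x \<partial>m) \<in> V} | (f :: 'a \<Rightarrow> real) V.
      continuous_on S f \<and> (\<exists>C. compact C \<and> C \<subseteq> S \<and> (\<forall>x \<in> S - C. f x = 0)) \<and> open V}"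
    by (intro CollectI exI[of _ "\<lambda>_. 0"] exI[of _ UNIV] conjI exI[of _ "{}"]) auto
  then show ?thesis
    unfolding vague_topology_def topology_generated_by_topspace
    by (intro equalityI Union_upper Union_least) auto
qed

lemma eventually_vague:
  fixes f :: "'a::topological_space \<Rightarrow> real"
  assumes "N \<in> Mp S" "continuous_on S f" "compact C" "C \<subseteq> S" "\<And>x. x \<in> S - C \<Longrightarrow> f x = 0"
    and "open V" "(\<integral>x. f x \<partial>N) \<in> V"
  shows "\<forall>\<^sub>F m in nhdsin (vague_topology S) N. m \<in> Mp S \<and> (\<integral>x. f x \<partial>m) \<in> V"
proof -
  have "openin (vague_topology S) {m \<in> Mp S. (\<integral>x. f x \<partial>m) \<in> V}"
    unfolding vague_topology_def
    by (rule topology_generated_by_Basis) (use assms in blast)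
  then show ?thesis
    using assms by (auto simp: eventually_nhdsin)
qed

lemma eventually_in_Mp: "\<forall>\<^sub>F m in nhdsin (vague_topology S) N. m \<in> Mp S"
  by (cases "N \<in> Mp S") (auto simp: eventually_nhdsin intro!: exI[of _ "topspace (vague_topology S)"])

text \<open>The tent function with peak 1 at \<open>p\<close> and radius \<open>r\<close> has
  integral at least 1 under \<open>N\<close>. A positive integral is a vaguely open condition and
  forces an atom inside the ball.\<close>

lemma eventually_hit_ball:
  fixes S :: "'a::heine_borel set"
  assumes "N \<in> Mp S" "closed S" "p \<in> atoms N" "0 < r"
  shows "\<forall>\<^sub>F m in nhdsin (vague_topology S) N. atoms m \<inter> ball p r \<noteq> {}"
proof -
  define f where "f q = max 0 (1 - dist p q / r)" for q
  have f: "continuous_on A f" "0 \<le> f q" "f q \<le> 1" "f p = 1" for q A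
    using assms(4) by (auto simp: f_def intro!: continuous_intros)
  have C: "compact (cball p r \<inter> S)" "cball p r \<inter> S \<subseteq> S"
    using assms(2) by (auto intro: compact_Int_closed)
  have out: "f q = 0" if "q \<notin> ball p r" for q
    using that assms(4) by (auto simp: f_def)
  have out': "f q = 0" if "q \<in> S - cball p r \<inter> S" for q
    using that by (intro out) auto
  have "1 \<le> (\<integral>q. f q \<partial>N)"
    using f by (intro integral_Mp_ge_1[OF assms(1) _ _ _ C out' assms(3)]) auto
  then have "\<forall>\<^sub>F m in nhdsin (vague_topology S) N. m \<in> Mp S \<and> (\<integral>q. f q \<partial>m) \<in> {0<..}"
    by (intro eventually_vague[OF assms(1) f(1) C out']) auto
  then show ?thesis
  proof (rule eventually_mono, elim conjE)
    fix m assume m: "m \<in> Mp S" "(\<integral>q. f q \<partial>m) \<in> {0<..}"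
    have "f \<in> borel_measurable (restrict_space borel S)"
      by (intro borel_measurable_continuous_on_restrict f)
    then have "\<exists>q\<in>atoms m. f q \<noteq> 0"
      using integral_Mp_eq_0[OF m(1), of f] m(2) by auto
    with out show "atoms m \<inter> ball p r \<noteq> {}" by blast
  qed
qed

text \<open>A limit point would have infinitely many atoms in its closed unit ball, whose trace on
  \<open>S\<close> is compact.\<close>

lemma closed_atoms:
  fixes S :: "'a::heine_borel set"
  assumes "N \<in> Mp S" "closed S"
  shows "closed (atoms N)"
  unfolding closed_limpt
proof (intro allI impI)
  fix x assume x: "x islimpt atoms N"
  have "finite (atoms N \<inter> (cball x 1 \<inter> S))"
    using assms by (intro finite_atoms_compact compact_Int_closed) auto
  moreover have "infinite (atoms N \<inter> cball x 1)"
    using x unfolding islimpt_eq_infinite_cball by (auto simp: zero_less_one)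
  moreover have "atoms N \<inter> (cball x 1 \<inter> S) = atoms N \<inter> cball x 1"
    using atoms_Mp_subset[OF assms(1)] by blast
  ultimately show "x \<in> atoms N" by simp
qed

text \<open>The test function is 1 on \<open>K\<close> and vanishes from distance \<open>d\<close>
  on, where \<open>d\<close> separates \<open>K\<close> from the closed set of atoms. Its integral
  is 0 under \<open>N\<close>, hence below 1 nearby, whereas an atom in \<open>K\<close> would make
  it at least 1.\<close>

lemma eventually_miss_compact:
  fixes S :: "'a::heine_borel set"
  assumes "N \<in> Mp S" "closed S" "compact K" "K \<subseteq> S" "atoms N \<inter> K = {}"
  shows "\<forall>\<^sub>F m in nhdsin (vague_topology S) N. atoms m \<inter> K = {}"
proof (cases "K = {}")
  case False
  obtain d where d: "0 < d" "\<And>x y. x \<in> K \<Longrightarrow> y \<in> atoms N \<Longrightarrow> d \<le> dist x y"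
    using separate_compact_closed[OF assms(3) closed_atoms[OF assms(1,2)]] assms(5) by blast
  define f where "f q = max 0 (1 - infdist q K / d)" for q
  have f: "continuous_on A f" "0 \<le> f q" "f q \<le> 1" for q A
    using d(1) by (auto simp: f_def infdist_nonneg intro!: continuous_intros)
  have fK: "f q = 1" if "q \<in> K" for q
    using that by (simp add: f_def)
  define C where "C = {q. infdist q K \<le> d} \<inter> S"
  have C: "compact C" "C \<subseteq> S"
    using compact_infdist_le[OF False assms(3) d(1)] assms(2) by (auto simp: C_def intro: compact_Int_closed)
  have out: "f q = 0" if "q \<in> S - C" for q
    using that d(1) by (auto simp: f_def C_def)
  have meas: "f \<in> borel_measurable (restrict_space borel S)"
    by (intro borel_measurable_continuous_on_restrict f)
  have "f q = 0" if "q \<in> atoms N" for q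
  proof -
    have "d \<le> infdist q K"
      using d(2)[OF _ that] False by (auto simp: infdist_notempty dist_commute intro!: cINF_greatest)
    then show ?thesis using d(1) by (simp add: f_def)
  qed
  then have "(\<integral>q. f q \<partial>N) = 0"
    by (intro integral_Mp_eq_0[OF assms(1) _ meas])
  then have "\<forall>\<^sub>F m in nhdsin (vague_topology S) N. m \<in> Mp S \<and> (\<integral>q. f q \<partial>m) \<in> {..<1}"
    by (intro eventually_vague[OF assms(1) f(1) C out]) auto
  then show ?thesis
  proof (rule eventually_mono, elim conjE)
    fix m assume m: "m \<in> Mp S" "(\<integral>q. f q \<partial>m) \<in> {..<1}"
    have False if "p \<in> atoms m" "p \<in> K" for p
      using integral_Mp_ge_1[OF m(1) f C out that(1) fK[OF that(2)]] m(2) by simp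
    then show "atoms m \<inter> K = {}" by blast
  qed
qed simp

section \<open>Deterministic continuity points of both maps\<close>

lemma closed_quadrant: "closed quadrant"
  unfolding quadrant_def by (intro closed_Times) auto

lemma quadrant_discrete_atoms:
  assumes "m \<in> Mp quadrant"
  shows "quadrant_discrete (atoms m)"
  unfolding quadrant_discrete_def
proof (intro conjI allI)
  show "atoms m \<subseteq> quadrant" by (rule atoms_Mp_subset[OF assms])
  show "finite (atoms m \<inter> {0..a} \<times> {0..b})" for a b
    by (rule finite_atoms_compact[OF assms]) (auto simp: quadrant_def intro!: compact_Times)
qed

lemma hit_miss_limit_atoms:
  assumes "N \<in> Mp quadrant"
  shows "hit_miss_limit atoms (atoms N) (nhdsin (vague_topology quadrant) N)"
  unfolding hit_miss_limit_def
proof (intro conjI ballI allI impI)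
  show "\<forall>\<^sub>F m in nhdsin (vague_topology quadrant) N. atoms m \<inter> ball p r \<noteq> {}"
    if "p \<in> atoms N" "0 < r" for p r
    using eventually_hit_ball[OF assms closed_quadrant that] .
  show "\<forall>\<^sub>F m in nhdsin (vague_topology quadrant) N. atoms m \<inter> {0..a} \<times> {0..b} = {}"
    if "atoms N \<inter> {0..a} \<times> {0..b} = {}" for a b
    using that
    by (intro eventually_miss_compact[OF assms closed_quadrant])
       (auto simp: quadrant_def intro!: compact_Times)
qed

text \<open>By definition an \<open>M1_open\<close> set contains a \<open>dM1_inf\<close> ball
  around each of its members, so it is enough to enter every ball; the balls themselves need not be
  open.\<close>

lemma topcontinuous_at_M1I:
  assumes "x \<in> topspace X" "\<And>y. y \<in> topspace X \<Longrightarrow> cadlag (f y)"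
    and "((\<lambda>y. dM1_inf (squash \<circ> f x) (squash \<circ> f y)) \<longlongrightarrow> 0) (nhdsin X x)"
  shows "topcontinuous_at X M1_topology f x"
  unfolding topcontinuous_at_def openin_M1_topology topspace_M1_topology
proof (intro conjI allI impI assms)
  show "f \<in> topspace X \<rightarrow> D_space" using assms(2) by (auto simp: D_space_def)
  fix V assume "M1_open V \<and> f x \<in> V"
  then obtain e where e: "0 < e"
    "\<And>g'. g' \<in> D_space \<Longrightarrow> dM1_inf (squash \<circ> f x) (squash \<circ> g') < e \<Longrightarrow> g' \<in> V"
    unfolding M1_open_def by metis
  have "\<forall>\<^sub>F y in nhdsin X x. dM1_inf (squash \<circ> f x) (squash \<circ> f y) < e"
    using assms(3) e(1) by (rule order_tendstoD)
  then obtain U where "openin X U" "x \<in> U" "\<And>y. y \<in> U \<Longrightarrow> dM1_inf (squash \<circ> f x) (squash \<circ> f y) < e"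
    using assms(1) by (auto simp: eventually_nhdsin)
  moreover from this have "y \<in> topspace X" if "y \<in> U" for y
    using openin_subset that by blast
  ultimately show "\<exists>U. openin X U \<and> x \<in> U \<and> (\<forall>y\<in>U. f y \<in> V)"
    using assms(2) e(2) by (intro exI[of _ U]) (auto simp: D_space_def)
qed

theorem topcontinuous_at_h1:
  assumes N: "N \<in> Mp quadrant"
    and "\<And>p. p \<in> atoms N \<Longrightarrow> 0 < fst p" "\<And>e. 0 < e \<Longrightarrow> \<exists>p\<in>atoms N. fst p < e"
  shows "topcontinuous_at (vague_topology quadrant) M1_topology h1 N"
proof -
  interpret vanishing_limit atoms "atoms N" "nhdsin (vague_topology quadrant) N"
    using assms eventually_in_Mp[of quadrant N]
    by unfold_locales
      (auto intro: hit_miss_limit_atoms quadrant_discrete_atoms elim: eventually_mono)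
  show ?thesis
  proof (rule topcontinuous_at_M1I)
    show "cadlag (h1 m)" if "m \<in> topspace (vague_topology quadrant)" for m
      using that by (simp add: h1_eq_profile profile_cadlag quadrant_discrete_atoms)
    show "((\<lambda>m. dM1_inf (squash \<circ> h1 N) (squash \<circ> h1 m)) \<longlongrightarrow> 0) (nhdsin (vague_topology quadrant) N)"
      unfolding h1_eq_profile by (rule dM1_inf_profile_tendsto_0)
  qed (use N in simp)
qed

theorem topcontinuous_at_h2:
  assumes N: "N \<in> Mp quadrant"
    and pos: "\<And>p. p \<in> atoms N \<Longrightarrow> 0 < snd p" and small: "\<And>e. 0 < e \<Longrightarrow> \<exists>p\<in>atoms N. snd p < e"
  shows "topcontinuous_at (vague_topology quadrant) M1_topology (\<lambda>m. right_version (h2 m)) N"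
proof -
  let ?F = "nhdsin (vague_topology quadrant) N"
  interpret vanishing_limit "\<lambda>m. prod.swap ` atoms m" "prod.swap ` atoms N" ?F
  proof
    show "hit_miss_limit (\<lambda>m. prod.swap ` atoms m) (prod.swap ` atoms N) ?F"
      by (intro hit_miss_limit_swap hit_miss_limit_atoms N)
    show "\<forall>\<^sub>F m in ?F. quadrant_discrete (prod.swap ` atoms m)"
      using eventually_in_Mp
      by (rule eventually_mono) (intro quadrant_discrete_swap quadrant_discrete_atoms)
    show "quadrant_discrete (prod.swap ` atoms N)"
      by (intro quadrant_discrete_swap quadrant_discrete_atoms N)
  qed (use pos small in auto)
  have rv: "right_version (h2 m) = profile (prod.swap ` atoms m)" if "m \<in> Mp quadrant" for m
    by (intro right_version_h2_eq_profile quadrant_discrete_atoms that)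
  show ?thesis
  proof (rule topcontinuous_at_M1I)
    show "cadlag (right_version (h2 m))" if "m \<in> topspace (vague_topology quadrant)" for m
      using that by (simp add: rv profile_cadlag quadrant_discrete_atoms quadrant_discrete_swap)
    show "((\<lambda>m. dM1_inf (squash \<circ> right_version (h2 N)) (squash \<circ> right_version (h2 m))) \<longlongrightarrow> 0) ?F"
    \<comment> \<open>The identification of the right version with a profile holds on
      \<open>Mp quadrant\<close> only, hence eventually along the filter.\<close>
    proof (rule Lim_transform_eventually[OF dM1_inf_profile_tendsto_0])
      show "\<forall>\<^sub>F m in ?F. dM1_inf (squash \<circ> profile (prod.swap ` atoms N)) (squash \<circ> profile (prod.swap ` atoms m)) =
          dM1_inf (squash \<circ> right_version (h2 N)) (squash \<circ> right_version (h2 m))"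
        using eventually_in_Mp by (rule eventually_mono) (simp add: rv N)
    qed
  qed (use N in simp)
qed


section \<open>Almost sure properties of processes of Mori--Hsing type\<close>

lemma space_Mp_algebra: "space (Mp_algebra S) = Mp S"
proof -
  have "{} \<in> sets (restrict_space borel S)" by simp
  then show ?thesis unfolding Mp_algebra_def space_Sup_eq_UN by auto
qed

text \<open>By independence, any n + 1 of the variables all lie in \<open>B\<close> with probability
  at most \<open>q ^ Suc n\<close>, which tends to 0.\<close>

lemma (in prob_space) indep_vars_AE_escape:
  assumes indep: "indep_vars (\<lambda>_. N) X I" and J: "infinite J" "J \<subseteq> I" and B: "B \<in> sets N"
    and q: "\<And>j. j \<in> J \<Longrightarrow> \<P>(\<omega> in M. X j \<omega> \<in> B) \<le> q" "q < 1"
  shows "AE \<omega> in M. \<exists>j\<in>J. X j \<omega> \<notin> B"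
proof -
  \<comment> \<open>Countability makes the intersection over all indices an event.\<close>
  obtain J' where J': "countable J'" "infinite J'" "J' \<subseteq> J"
    using infinite_countable_subset'[OF J(1)] by blast
  have "J' \<noteq> {}" using J'(2) by auto
  have meas: "X j -` B \<inter> space M \<in> events" if "j \<in> J'" for j
    using indep B that J J' by (auto simp: indep_vars_def2 intro: measurable_sets)
  have ev: "(\<Inter>j\<in>J'. X j -` B \<inter> space M) \<in> events"
    using J' meas by (intro sets.countable_INT') auto
  have le: "prob (\<Inter>j\<in>J'. X j -` B \<inter> space M) \<le> q ^ Suc n" for n
  proof -
    obtain F where F: "F \<subseteq> J'" "finite F" "card F = Suc n"
      using infinite_arbitrarily_large[OF J'(2)] by blast
    then have "F \<noteq> {}" by auto
    have "prob (\<Inter>j\<in>J'. X j -` B \<inter> space M) \<le> prob (\<Inter>j\<in>F. X j -` B \<inter> space M)"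
      using F meas \<open>F \<noteq> {}\<close> by (intro finite_measure_mono sets.finite_INT) auto
    also have "\<dots> = (\<Prod>j\<in>F. prob (X j -` B \<inter> space M))"
      using F J J' B \<open>F \<noteq> {}\<close> by (intro indep_varsD[OF indep]) auto
    also have "\<dots> \<le> (\<Prod>j\<in>F. q)"
    proof (intro prod_mono conjI measure_nonneg)
      fix j assume "j \<in> F"
      then have "\<P>(\<omega> in M. X j \<omega> \<in> B) \<le> q" using F J' q(1) by blast
      moreover have "X j -` B \<inter> space M = {\<omega> \<in> space M. X j \<omega> \<in> B}" by auto
      ultimately show "prob (X j -` B \<inter> space M) \<le> q" by simp
    qed
    also have "\<dots> = q ^ Suc n" using F by simp
    finally show ?thesis .
  qed
  have "0 \<le> q"
  proof -
    obtain j where "j \<in> J" using J(1) by (metis ex_in_conv finite.emptyI)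
    then show ?thesis using q(1) measure_nonneg order_trans by blast
  qed
  then have "(\<lambda>n. q ^ Suc n) \<longlonglongrightarrow> 0"
    using q(2) by (intro LIMSEQ_Suc LIMSEQ_power_zero) auto
  then have "prob (\<Inter>j\<in>J'. X j -` B \<inter> space M) \<le> 0"
    by (rule LIMSEQ_le_const) (use le in blast)
  then have "prob (\<Inter>j\<in>J'. X j -` B \<inter> space M) = 0"
    by (simp add: measure_le_0_iff)
  then have "AE \<omega> in M. \<omega> \<notin> (\<Inter>j\<in>J'. X j -` B \<inter> space M)"
    using ev by (intro AE_not_in) (auto simp: null_sets_def emeasure_eq_measure)
  with AE_space show ?thesis
    by eventually_elim (use J'(3) \<open>J' \<noteq> {}\<close> in auto)
qed

text \<open>Each term above 1 raises the partial sums by more than 1, there are such terms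
  arbitrarily late, and the partial sums never decrease.\<close>

lemma sum_unbounded:
  fixes a :: "nat \<Rightarrow> real"
  assumes "\<And>n. 0 \<le> a n" "\<And>n. \<exists>j\<ge>n. 1 < a j"
  shows "finite {j. (\<Sum>k\<le>j. a k) \<le> R}"
proof -
  have mono: "(\<Sum>k\<le>i. a k) \<le> (\<Sum>k\<le>j. a k)" if "i \<le> j" for i j
    using that assms(1) by (intro sum_mono2) auto
  have "\<exists>j. real n \<le> (\<Sum>k\<le>j. a k)" for n
  proof (induction n)
    case 0
    then show ?case by (auto intro: sum_nonneg assms(1))
  next
    case (Suc n)
    then obtain j where j: "real n \<le> (\<Sum>k\<le>j. a k)" by blast
    obtain i where i: "Suc j \<le> i" "1 < a i" using assms(2) by blast
    then obtain i' where i': "i = Suc i'" "j \<le> i'" by (cases i) auto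
    have "real (Suc n) \<le> (\<Sum>k\<le>i. a k)"
      using j i mono[OF i'(2)] by (simp add: i'(1))
    then show ?case by blast
  qed
  moreover obtain n where "R < real n" using reals_Archimedean2 by blast
  ultimately obtain j where j: "R < (\<Sum>k\<le>j. a k)" by (meson less_le_trans)
  have "{j. (\<Sum>k\<le>j. a k) \<le> R} \<subseteq> {..<j}"
  proof
    fix i assume "i \<in> {j. (\<Sum>k\<le>j. a k) \<le> R}"
    then show "i \<in> {..<j}" using mono[of j i] j by (cases "i < j") auto
  qed
  then show ?thesis by (rule finite_subset) simp
qed

section \<open>Almost sure events and their consequences for each outcome\<close>

context mori_hsing
begin

lemma U_measurable [measurable]: "U i j \<in> borel_measurable M"
  using U_indep by (auto simp: indep_vars_def2)

lemma AE_U_mem: "AE \<omega> in M. U i j \<omega> \<in> {real i <.. real i + 1}"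
proof (rule AE_distrD[where f = "U i j" and M' = lborel])
  show "U i j \<in> measurable M lborel" by simp
  show "AE x in distr M lborel (U i j). x \<in> {real i <.. real i + 1}"
    unfolding U_uniform by (intro AE_uniform_measureI) auto
qed

lemma prob_U_gt:
  assumes "0 \<le> e" "e \<le> 1"
  shows "\<P>(\<omega> in M. U 0 j \<omega> \<in> {e<..}) = 1 - e"
proof -
  have "\<P>(\<omega> in M. U 0 j \<omega> \<in> {e<..}) = measure (distr M lborel (U 0 j)) {e<..}"
    by (subst measure_distr) (auto intro!: arg_cong[where f = prob])
  also have "\<dots> = measure lborel ({0<..1} \<inter> {e<..}) / measure lborel {0<..1::real}"
    unfolding U_uniform by (subst measure_uniform_measure) auto
  also have "{0<..1} \<inter> {e<..} = {e<..1}" using assms by auto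
  finally show ?thesis using assms by simp
qed

lemma AE_Tbar_pos: "AE \<omega> in M. 0 < Tbar i j \<omega>"
proof -
  have "\<P>(\<omega> in M. 0 < Tbar i j \<omega>) = 1"
    using exponential_distributedD_gt[OF Tbar_exponential, of 0 i j] theta by simp
  moreover have [measurable]: "Tbar i j \<in> borel_measurable M"
    using Tbar_exponential[of i j] by (auto simp: distributed_def)
  ultimately show ?thesis by (subst (asm) prob_Collect_eq_1) auto
qed

text \<open>Within one row the variables are independent and stay below 1 with the same probability
  \<open>1 - exp (- \<theta>)\<close> < 1. Through \<open>sum_unbounded\<close>, each row then has
  finitely many times in a bounded interval.\<close>

lemma AE_Tbar_large: "AE \<omega> in M. \<exists>j\<ge>n. 1 < Tbar i j \<omega>"
proof -
  have "infinite ({i} \<times> {n..})" by (auto simp: finite_cartesian_product_iff infinite_Ici)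
  moreover have "\<P>(\<omega> in M. Tbar i j \<omega> \<in> {..1}) = 1 - exp (- \<theta>)" for j
    using exponential_distributedD_le[OF Tbar_exponential, of 1 i j] theta by simp
  ultimately have "AE \<omega> in M. \<exists>(i, j)\<in>{i} \<times> {n..}. Tbar i j \<omega> \<notin> {..1}"
    using indep_vars_AE_escape[OF Tbar_indep, of "{i} \<times> {n..}" "{..1}" "1 - exp (- \<theta>)"]
    by (auto simp: split_beta)
  then show ?thesis by (rule eventually_mono) (auto simp: not_le)
qed

text \<open>Here the escape runs across rows: the first times of the rows are independent and
  identically distributed. This provides atoms near time 0.\<close>

lemma AE_Tbar_small:
  assumes "0 < e"
  shows "AE \<omega> in M. \<exists>i. Tbar i 0 \<omega> \<le> e"
proof -
  have "infinite ((UNIV :: nat set) \<times> {0 :: nat})" by (auto simp: finite_cartesian_product_iff)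
  moreover have "\<P>(\<omega> in M. Tbar i 0 \<omega> \<in> {e<..}) = exp (- e * \<theta>)" for i
    using exponential_distributedD_gt[OF Tbar_exponential, of e i 0] theta assms by simp
  moreover have "exp (- e * \<theta>) < 1" using assms theta by simp
  ultimately have "AE \<omega> in M. \<exists>(i, j)\<in>UNIV \<times> {0}. Tbar i j \<omega> \<notin> {e<..}"
    using indep_vars_AE_escape[OF Tbar_indep, of "UNIV \<times> {0}" "{e<..}" "exp (- e * \<theta>)"]
    by (auto simp: split_beta)
  then show ?thesis by (rule eventually_mono) (auto simp: not_less)
qed

text \<open>Within row 0 all \<open>U\<close> are uniform on (0,1]. This provides atoms near height
  0.\<close>

lemma AE_U_small:
  assumes "0 < e" "e \<le> 1"
  shows "AE \<omega> in M. \<exists>j. U 0 j \<omega> \<le> e"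
proof -
  have "infinite ({0 :: nat} \<times> (UNIV :: nat set))" by (auto simp: finite_cartesian_product_iff)
  then have "AE \<omega> in M. \<exists>(i, j)\<in>{0} \<times> UNIV. U i j \<omega> \<notin> {e<..}"
    using indep_vars_AE_escape[OF U_indep, of "{0} \<times> UNIV" "{e<..}" "1 - e"] assms
    by (auto simp: split_beta prob_U_gt simp del: greaterThan_iff)
  then show ?thesis by (rule eventually_mono) (auto simp: not_less)
qed

text \<open>The almost sure event on which the rest is deterministic. Arbitrary e > 0 is replaced by
  the sequence 1 / (n + 1), so that countably many null sets suffice.\<close>

definition good :: "'w \<Rightarrow> bool" where
  "good \<omega> \<longleftrightarrow> \<omega> \<in> space M \<and> (\<forall>i j. 0 < Tbar i j \<omega>) \<and> (\<forall>i n. \<exists>j\<ge>n. 1 < Tbar i j \<omega>) \<and>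
    (\<forall>i j. U i j \<omega> \<in> {real i <.. real i + 1}) \<and> (\<forall>i j. 1 \<in> atoms (MH_cluster K Y i j \<omega>)) \<and>
    (\<forall>n. \<exists>i. Tbar i 0 \<omega> \<le> 1 / real (Suc n)) \<and> (\<forall>n. \<exists>j. U 0 j \<omega> \<le> 1 / real (Suc n))"

lemma AE_good: "AE \<omega> in M. good \<omega>"
  unfolding good_def
  by (intro AE_conjI AE_all_countable[THEN iffD2] allI AE_space AE_Tbar_pos AE_Tbar_large
      AE_U_mem cluster_atom AE_Tbar_small AE_U_small) auto

lemma U_bounds:
  assumes "good \<omega>"
  shows "0 < U i j \<omega>" "real i < U i j \<omega>"
proof -
  show "real i < U i j \<omega>" using assms by (auto simp: good_def)
  then show "0 < U i j \<omega>" by (rule le_less_trans[rotated]) simp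
qed

definition points :: "'w \<Rightarrow> (nat \<times> nat \<times> nat) \<Rightarrow> real \<times> real" where
  "points \<omega> = (\<lambda>(i, j, l). (\<Sum>k\<le>j. Tbar i k \<omega>, U i j \<omega> * Y i j l \<omega>))"

definition labels :: "'w \<Rightarrow> (nat \<times> nat \<times> nat) set" where
  "labels \<omega> = {(i, j, l). enat l < K i j \<omega>}"

lemma MH_process_eq: "MH_process Tbar U K Y \<omega> = dirac_sum quadrant (labels \<omega>) (points \<omega>)"
  by (simp add: MH_process_def labels_def points_def)

context
  fixes \<omega> assumes good: "good \<omega>"
begin

lemma T_pos: "0 < (\<Sum>k\<le>j. Tbar i k \<omega>)"
  using good by (intro sum_pos) (auto simp: good_def)

lemma Y_ge: "(i, j, l) \<in> labels \<omega> \<Longrightarrow> 1 \<le> Y i j l \<omega>"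
  using good Y_ge_1 by (auto simp: good_def labels_def)

lemma U_le_point: "(i, j, l) \<in> labels \<omega> \<Longrightarrow> U i j \<omega> \<le> U i j \<omega> * Y i j l \<omega>"
  using Y_ge U_bounds(1)[OF good, of i j] by simp

lemma points_pos:
  assumes "p \<in> labels \<omega>"
  shows "0 < fst (points \<omega> p)" "0 < snd (points \<omega> p)"
  using assms T_pos U_le_point U_bounds(1)[OF good]
  by (cases p; force simp: points_def intro: less_le_trans)+

lemma points_in_quadrant: "points \<omega> \<in> labels \<omega> \<rightarrow> quadrant"
  using points_pos by (force simp: quadrant_def mem_Times_iff intro: less_imp_le)

text \<open>Dividing by \<open>U i j \<omega>\<close> > 0 confines the points of the cluster to a
  compact subset of [1,\<infinity>).\<close>

lemma finite_cluster_below: "finite {l. enat l < K i j \<omega> \<and> U i j \<omega> * Y i j l \<omega> \<le> R}"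
proof -
  let ?L = "{l. enat l < K i j \<omega>}" and ?C = "{1..R / U i j \<omega>}"
  \<comment> \<open>Measurability into \<open>Mp_algebra {1..}\<close> includes that the cluster is
    a Radon point measure.\<close>
  have "MH_cluster K Y i j \<omega> \<in> Mp {1..}"
    using measurable_space[OF cluster_measurable] good by (auto simp: space_Mp_algebra good_def)
  then have "emeasure (dirac_sum {1..} ?L (\<lambda>l. Y i j l \<omega>)) ?C < \<infinity>"
    unfolding MH_cluster_def by (rule emeasure_Mp_compact) auto
  moreover have "(\<lambda>l. Y i j l \<omega>) \<in> ?L \<rightarrow> {1..}"
    using Y_ge by (auto simp: labels_def)
  ultimately have "finite ((\<lambda>l. Y i j l \<omega>) -` ?C \<inter> ?L)"
    by (intro finite_preimage_compact) auto
  then show ?thesis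
    by (rule rev_finite_subset)
       (use U_bounds(1)[OF good] Y_ge in \<open>auto simp: labels_def field_simps\<close>)
qed

text \<open>A bound R on both coordinates limits all three indices: i since i < U \<le> U Y \<le> R,
  j since the times of row i are unbounded, and l by finiteness within one cluster.\<close>

lemma MH_process_in_Mp: "MH_process Tbar U K Y \<omega> \<in> Mp quadrant"
  unfolding MH_process_eq
proof (rule dirac_sum_in_Mp[OF points_in_quadrant])
  fix C :: "(real \<times> real) set" assume "compact C"
  then obtain R where R: "\<And>p. p \<in> C \<Longrightarrow> norm p \<le> R"
    by (meson bounded_iff compact_imp_bounded)
  have le: "fst p \<le> R" "snd p \<le> R" if "p \<in> C" for p
    using R[OF that] norm_fst_le[of "fst p" "snd p"] norm_snd_le[of "snd p" "fst p"] by auto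
  let ?J = "\<lambda>i. {j. (\<Sum>k\<le>j. Tbar i k \<omega>) \<le> R}"
  let ?L = "\<lambda>i j. {l. enat l < K i j \<omega> \<and> U i j \<omega> * Y i j l \<omega> \<le> R}"
  have "points \<omega> -` C \<inter> labels \<omega> \<subseteq> (SIGMA i:{i. real i \<le> R}. SIGMA j:?J i. ?L i j)"
  proof
    fix p assume p: "p \<in> points \<omega> -` C \<inter> labels \<omega>"
    obtain i j l where [simp]: "p = (i, j, l)" by (cases p)
    have mem: "(i, j, l) \<in> labels \<omega>"
      and T: "(\<Sum>k\<le>j. Tbar i k \<omega>) \<le> R" and UY: "U i j \<omega> * Y i j l \<omega> \<le> R"
      using p le[of "points \<omega> p"] by (auto simp: points_def)
    have "real i \<le> R"
      using U_le_point[OF mem] U_bounds(2)[OF good, of i j] UY by linarith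
    with mem T UY show "p \<in> (SIGMA i:{i. real i \<le> R}. SIGMA j:?J i. ?L i j)"
      by (simp add: labels_def)
  qed
  moreover have "finite (?J i)" for i
    using good by (intro sum_unbounded) (auto simp: good_def intro: less_imp_le)
  moreover have "{i. real i \<le> R} \<subseteq> {..nat \<lfloor>R\<rfloor>}" by (auto simp: le_nat_floor)
  then have "finite {i. real i \<le> R}" by (rule finite_subset) simp
  ultimately show "finite (points \<omega> -` C \<inter> labels \<omega>)"
    using finite_cluster_below by (elim finite_subset) (intro finite_SigmaI)
qed

lemma atoms_MH_process: "atoms (MH_process Tbar U K Y \<omega>) = points \<omega> ` labels \<omega>"
  unfolding MH_process_eq by (rule atoms_dirac_sum[OF points_in_quadrant])

text \<open>The atom 1 of the cluster puts a point at height exactly \<open>U i j \<omega>\<close>,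
  which turns small values of \<open>Tbar\<close> and \<open>U\<close> into atoms near the
  axes.\<close>

lemma bottom_point: "(\<Sum>k\<le>j. Tbar i k \<omega>, U i j \<omega>) \<in> atoms (MH_process Tbar U K Y \<omega>)"
proof -
  have "1 \<in> (\<lambda>l. Y i j l \<omega>) ` {l. enat l < K i j \<omega>}"
    using good Y_ge
    by (subst atoms_dirac_sum[symmetric, where S = "{1..}"]) (auto simp: good_def MH_cluster_def labels_def)
  then obtain l where "enat l < K i j \<omega>" "Y i j l \<omega> = 1" by auto
  then show ?thesis
    unfolding atoms_MH_process by (intro image_eqI[of _ _ "(i, j, l)"]) (auto simp: points_def labels_def)
qed

lemma topcontinuous_at_MH_process:
  "topcontinuous_at (vague_topology quadrant) M1_topology h1 (MH_process Tbar U K Y \<omega>)"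
  "topcontinuous_at (vague_topology quadrant) M1_topology (\<lambda>m. right_version (h2 m))
     (MH_process Tbar U K Y \<omega>)"
proof -
  let ?N = "MH_process Tbar U K Y \<omega>"
  show "topcontinuous_at (vague_topology quadrant) M1_topology h1 ?N"
  proof (rule topcontinuous_at_h1[OF MH_process_in_Mp])
    show "0 < fst p" if "p \<in> atoms ?N" for p
      using that points_pos unfolding atoms_MH_process by blast
    fix e :: real assume "0 < e"
    then obtain n where "1 / real (Suc n) < e" using nat_approx_posE by blast
    moreover obtain i where "Tbar i 0 \<omega> \<le> 1 / real (Suc n)" using good unfolding good_def by blast
    ultimately show "\<exists>p\<in>atoms ?N. fst p < e"
      using bottom_point[of i 0] by (intro bexI) auto
  qed
  show "topcontinuous_at (vague_topology quadrant) M1_topology (\<lambda>m. right_version (h2 m)) ?N"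
  proof (rule topcontinuous_at_h2[OF MH_process_in_Mp])
    show "0 < snd p" if "p \<in> atoms ?N" for p
      using that points_pos unfolding atoms_MH_process by blast
    fix e :: real assume "0 < e"
    then obtain n where "1 / real (Suc n) < e" using nat_approx_posE by blast
    moreover obtain j where "U 0 j \<omega> \<le> 1 / real (Suc n)" using good unfolding good_def by blast
    ultimately show "\<exists>p\<in>atoms ?N. snd p < e"
      using bottom_point[of 0 j] by (intro bexI) auto
  qed
qed

end

end

theorem theorem5p2:
  fixes M :: "'w measure"
    and \<theta> :: real
    and Tbar U :: "nat \<Rightarrow> nat \<Rightarrow> 'w \<Rightarrow> real"
    and K :: "nat \<Rightarrow> nat \<Rightarrow> 'w \<Rightarrow> enat"
    and Y :: "nat \<Rightarrow> nat \<Rightarrow> nat \<Rightarrow> 'w \<Rightarrow> real"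
  assumes "mori_hsing M \<theta> Tbar U K Y"
  shows "AE \<omega> in M.
           topcontinuous_at (vague_topology quadrant) M1_topology
             h1 (MH_process Tbar U K Y \<omega>) \<and>
           topcontinuous_at (vague_topology quadrant) M1_topology
             (\<lambda>m. right_version (h2 m)) (MH_process Tbar U K Y \<omega>)"
proof -
  interpret mori_hsing M \<theta> Tbar U K Y by fact
  show ?thesis
    using AE_good by (rule eventually_mono) (intro conjI topcontinuous_at_MH_process)
qed

end
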